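(* Let $p\ge 1$ and let $0 =: k_0 < k_1 < \cdots < k_p < k_{p+1} := n$ be integers, set $n_{i+1} := k_{i+1}-k_i$ for $i=0,\dots,p$, and let $a_1,\dots,a_{p+1}\in\mathbb{R}$ be distinct. Then the map $$\varphi_4:\operatorname{Flag}_{a_1,\dots,a_{p+1}}(k_1,\dots,k_p,n)\to\operatorname{Flag}(k_1,\dots,k_p,\mathbb{R}^n),\qquad Q\operatorname{diag}(a_1I_{n_1},\dots,a_{p+1}I_{n_{p+1}})Q^{\mathsf T}\mapsto(\mathbb{Q}_1,\dots,\mathbb{Q}_p),$$ where $Q\in\operatorname{SO}_n(\mathbb{R})$ and $\mathbb{Q}_j\subseteq\mathbb{R}^n$ is the subspace spanned by the first $k_j$ column vectors of $Q$, $j=1,\dots,p$, is a (well-defined) diffeomorphism.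
   Context: $\operatorname{Flag}(k_1,\dots,k_p,\mathbb{R}^n)$ is the smooth manifold of flags $\mathbb{W}_1\subseteq\cdots\subseteq\mathbb{W}_p\subseteq\mathbb{R}^n$ of linear subspaces with $\dim\mathbb{W}_i=k_i$. The isospectral model is $$\operatorname{Flag}_{a_1,\dots,a_{p+1}}(k_1,\dots,k_p,n) := \Bigl\{ X\in \mathsf{S}^2(\mathbb{R}^n) : \prod_{j=0}^{p} (X - a_{j+1} I_n) = 0,\ \operatorname{tr}(X^i) = \sum_{j=0}^{p} n_{j+1} a_{j+1}^i,\ i=1,\dots,p \Bigr\},$$ which equals $\{Q\operatorname{diag}(a_1I_{n_1},\dots,a_{p+1}I_{n_{p+1}})Q^{\mathsf T}:Q\in\operatorname{SO}_n(\mathbb{R})\}$; it is regarded as a submanifold of the space $\mathsf{S}^2(\mathbb{R}^n)$ of real symmetric $n\times n$ matrices. *)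

theory Defs
  imports "HOL-Analysis.Analysis"
begin

section \<open>Smooth maps between subsets of normed spaces\<close>

fun higher_differentiable_on ::
  "'a::real_normed_vector set \<Rightarrow> ('a \<Rightarrow> 'b::real_normed_vector) \<Rightarrow> nat \<Rightarrow> bool" where
  "higher_differentiable_on W f 0 \<longleftrightarrow> continuous_on W f"
| "higher_differentiable_on W f (Suc m) \<longleftrightarrow>
     (\<forall>x\<in>W. f differentiable (at x)) \<and>
     (\<forall>v. higher_differentiable_on W (\<lambda>x. frechet_derivative f (at x) v) m)"

text \<open>A map on an arbitrary subset is smooth if it extends, locally around each point of the subset,
  to a \<open>C\<^sup>\<infinity>\<close> map on an open set.  For a relatively open subset of a linear subspace this is the usual
  notion of smoothness on that subspace.\<close>

definition smooth_on :: "'a::real_normed_vector set \<Rightarrow> ('a \<Rightarrow> 'b::real_normed_vector) \<Rightarrow> bool" where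
  "smooth_on A f \<longleftrightarrow>
     (\<forall>x\<in>A. \<exists>W g. open W \<and> x \<in> W \<and> (\<forall>m. higher_differentiable_on W g m) \<and>
                  (\<forall>y\<in>W \<inter> A. g y = f y))"

section \<open>Smooth manifolds given by an atlas\<close>

text \<open>A chart is a pair of a domain and a coordinate map, whose values outside the domain are
  irrelevant.  Instead of \<open>\<real>\<^sup>d\<close>, a chart takes values in a \<open>d\<close>-dimensional linear subspace of
  the Euclidean space \<open>'e\<close>.\<close>

type_synonym ('a, 'e) chart = "'a set \<times> ('a \<Rightarrow> 'e)"

definition atlas_topology :: "'a set \<Rightarrow> ('a, 'e::euclidean_space) chart set \<Rightarrow> 'a topology" where
  "atlas_topology M \<A> = topology (\<lambda>W. W \<subseteq> M \<and>
     (\<forall>(U, \<phi>)\<in>\<A>. openin (top_of_set (\<phi> ` U)) (\<phi> ` (U \<inter> W))))"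

definition smooth_atlas :: "'a set \<Rightarrow> ('a, 'e::euclidean_space) chart set \<Rightarrow> bool" where
  "smooth_atlas M \<A> \<longleftrightarrow>
     (\<Union>(U, \<phi>)\<in>\<A>. U) = M \<and>
     (\<exists>d. \<forall>(U, \<phi>)\<in>\<A>. inj_on \<phi> U \<and>
        (\<exists>E. subspace E \<and> dim E = d \<and> openin (top_of_set E) (\<phi> ` U))) \<and>
     (\<forall>(U, \<phi>)\<in>\<A>. \<forall>(V, \<psi>)\<in>\<A>.
        openin (top_of_set (\<phi> ` U)) (\<phi> ` (U \<inter> V)) \<and>
        smooth_on (\<phi> ` (U \<inter> V)) (\<psi> \<circ> inv_into U \<phi>))"

definition smooth_manifold :: "'a set \<Rightarrow> ('a, 'e::euclidean_space) chart set \<Rightarrow> bool" where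
  "smooth_manifold M \<A> \<longleftrightarrow> smooth_atlas M \<A> \<and>
     Hausdorff_space (atlas_topology M \<A>) \<and> second_countable (atlas_topology M \<A>)"

definition smooth_map ::
  "'a set \<Rightarrow> ('a, 'e::euclidean_space) chart set \<Rightarrow>
   'b set \<Rightarrow> ('b, 'f::euclidean_space) chart set \<Rightarrow> ('a \<Rightarrow> 'b) \<Rightarrow> bool" where
  "smooth_map M \<A> N \<B> f \<longleftrightarrow>
     continuous_map (atlas_topology M \<A>) (atlas_topology N \<B>) f \<and>
     (\<forall>(U, \<phi>)\<in>\<A>. \<forall>(V, \<psi>)\<in>\<B>.
        smooth_on (\<phi> ` (U \<inter> f -` V)) (\<psi> \<circ> f \<circ> inv_into U \<phi>))"

definition diffeomorphism ::
  "'a set \<Rightarrow> ('a, 'e::euclidean_space) chart set \<Rightarrow>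
   'b set \<Rightarrow> ('b, 'f::euclidean_space) chart set \<Rightarrow> ('a \<Rightarrow> 'b) \<Rightarrow> bool" where
  "diffeomorphism M \<A> N \<B> f \<longleftrightarrow>
     smooth_manifold M \<A> \<and> smooth_manifold N \<B> \<and> bij_betw f M N \<and>
     smooth_map M \<A> N \<B> f \<and> smooth_map N \<B> M \<A> (inv_into M f)"

lemma openin_atlas_topology:
  assumes "\<And>U \<phi>. (U, \<phi>) \<in> \<A> \<Longrightarrow> inj_on \<phi> U"
  shows "openin (atlas_topology M \<A>) W \<longleftrightarrow> W \<subseteq> M \<and>
    (\<forall>(U, \<phi>)\<in>\<A>. openin (top_of_set (\<phi> ` U)) (\<phi> ` (U \<inter> W)))"
proof -
  let ?L = "\<lambda>W. W \<subseteq> M \<and> (\<forall>(U, \<phi>)\<in>\<A>. openin (top_of_set (\<phi> ` U)) (\<phi> ` (U \<inter> W)))"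
  have "istopology ?L"
    unfolding istopology_def
  proof (intro conjI allI impI)
    fix S T assume S: "?L S" and T: "?L T"
    have "openin (top_of_set (\<phi> ` U)) (\<phi> ` (U \<inter> (S \<inter> T)))" if "(U, \<phi>) \<in> \<A>" for U \<phi>
    proof -
      have "\<phi> ` (U \<inter> (S \<inter> T)) = \<phi> ` (U \<inter> S) \<inter> \<phi> ` (U \<inter> T)"
        using inj_on_image_Int[OF assms[OF that], of "U \<inter> S" "U \<inter> T"]
        by (simp add: Int_ac)
      then show ?thesis using S T that by auto
    qed
    then show "S \<inter> T \<subseteq> M"
      and "\<forall>(U, \<phi>)\<in>\<A>. openin (top_of_set (\<phi> ` U)) (\<phi> ` (U \<inter> (S \<inter> T)))"
      using S by auto
  next
    fix K assume K: "\<forall>S\<in>K. ?L S"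
    then show "\<Union>K \<subseteq> M" by blast
    have "openin (top_of_set (\<phi> ` U)) (\<phi> ` (U \<inter> \<Union>K))" if "(U, \<phi>) \<in> \<A>" for U \<phi>
    proof -
      have "\<phi> ` (U \<inter> \<Union>K) = (\<Union>S\<in>K. \<phi> ` (U \<inter> S))" by blast
      moreover have "openin (top_of_set (\<phi> ` U)) (\<Union>S\<in>K. \<phi> ` (U \<inter> S))"
        using K that by (intro openin_Union) blast
      ultimately show ?thesis by simp
    qed
    then show "\<forall>(U, \<phi>)\<in>\<A>. openin (top_of_set (\<phi> ` U)) (\<phi> ` (U \<inter> \<Union>K))" by blast
  qed
  then show ?thesis
    unfolding atlas_topology_def by (simp add: topology_inverse')
qed

text \<open>The charts of a subset \<open>S\<close> of Euclidean space are all diffeomorphisms from relatively open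
  subsets of \<open>S\<close> to open subsets of linear subspaces; \<open>S\<close> is an embedded submanifold precisely when
  the domains of such charts of one fixed dimension cover it.  If \<open>S\<close> lies in a linear subspace of
  \<open>'e\<close>, its structure as a submanifold of that subspace is the same.\<close>

definition submanifold_atlas :: "'e::euclidean_space set \<Rightarrow> ('e, 'e) chart set" where
  "submanifold_atlas S = {(U, \<phi>). openin (top_of_set S) U \<and> inj_on \<phi> U \<and>
     (\<exists>E. subspace E \<and> openin (top_of_set E) (\<phi> ` U)) \<and>
     smooth_on U \<phi> \<and> smooth_on (\<phi> ` U) (inv_into U \<phi>)}"

section \<open>Flags\<close>

text \<open>Abbreviations, since the notation \<open>real^'n\<close> forces the sort of \<open>'n\<close> to be just \<open>finite\<close>.\<close>

type_synonym 'n rvec = "real^'n"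
type_synonym 'n rmat = "real^'n^'n"

text \<open>Rows and columns are indexed by a finite linearly ordered type \<open>'n\<close> with \<open>n = CARD('n)\<close>.
  The number \<open>position i\<close> counts from \<open>0\<close>, so the first \<open>m\<close> columns are those with
  \<open>position i < m\<close>.  The number \<open>block k i\<close> counts from \<open>1\<close>: it is the \<open>j\<close> with
  \<open>k (j - 1) \<le> position i < k j\<close>, for increasing \<open>k\<close> with \<open>k 0 = 0\<close>.\<close>

definition position :: "'n::{finite,linorder} \<Rightarrow> nat" where
  "position i = card {j. j < i}"

definition block :: "(nat \<Rightarrow> nat) \<Rightarrow> 'n::{finite,linorder} \<Rightarrow> nat" where
  "block k i = (LEAST j. position i < k j)"

definition flag_set :: "nat \<Rightarrow> (nat \<Rightarrow> nat) \<Rightarrow> (nat \<Rightarrow> (real^'n) set) set" where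
  "flag_set p k = {F \<in> (\<Pi>\<^sub>E j\<in>{1..p}. {W. subspace W \<and> dim W = k j}).
     \<forall>j\<in>{1..<p}. F j \<subseteq> F (Suc j)}"

definition column_flag ::
  "nat \<Rightarrow> (nat \<Rightarrow> nat) \<Rightarrow> 'n::{finite,linorder} rmat \<Rightarrow> nat \<Rightarrow> 'n rvec set" where
  "column_flag p k Q = (\<lambda>j\<in>{1..p}. span {column i Q |i. position i < k j})"

text \<open>The standard smooth structure of the flag manifold, by big cells: every invertible \<open>g\<close> gives
  the parametrization \<open>N \<mapsto> column_flag p k (g ** (mat 1 + N))\<close> of a neighbourhood of
  \<open>column_flag p k g\<close> by the strictly lower block triangular matrices \<open>N\<close>.  The chart is the inverse
  of this parametrization.\<close>

definition strictly_block_lower :: "(nat \<Rightarrow> nat) \<Rightarrow> 'n::{finite,linorder} rmat set" where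
  "strictly_block_lower k = {N. \<forall>i j. N $ i $ j \<noteq> 0 \<longrightarrow> block k j < block k i}"

definition cell_param ::
  "nat \<Rightarrow> (nat \<Rightarrow> nat) \<Rightarrow> 'n rmat \<Rightarrow> 'n::{finite,linorder} rmat \<Rightarrow> nat \<Rightarrow> 'n rvec set" where
  "cell_param p k g N = column_flag p k (g ** (mat 1 + N))"

definition flag_atlas ::
  "nat \<Rightarrow> (nat \<Rightarrow> nat) \<Rightarrow> (nat \<Rightarrow> 'n rvec set, 'n::{finite,linorder} rmat) chart set" where
  "flag_atlas p k =
     {(cell_param p k g ` strictly_block_lower k,
       inv_into (strictly_block_lower k) (cell_param p k g)) |g. invertible g}"

section \<open>The isospectral model\<close>

text \<open>The library's power on \<open>real^'n^'n\<close> would be componentwise, hence an explicit matrix power.\<close>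

definition matrix_power :: "real^'n^'n \<Rightarrow> nat \<Rightarrow> real^'n^'n" where
  "matrix_power X m = (((**) X) ^^ m) (mat 1)"

definition isospectral_flags ::
  "nat \<Rightarrow> (nat \<Rightarrow> nat) \<Rightarrow> (nat \<Rightarrow> real) \<Rightarrow> (real^'n^'n) set" where
  "isospectral_flags p k a = {X. transpose X = X \<and>
     foldr (\<lambda>j B. (X - mat (a (Suc j))) ** B) [0..<Suc p] (mat 1) = 0 \<and>
     (\<forall>i\<in>{1..p}. trace (matrix_power X i) = (\<Sum>j=0..p. real (k (Suc j) - k j) * a (Suc j) ^ i))}"

definition block_diag :: "(nat \<Rightarrow> nat) \<Rightarrow> (nat \<Rightarrow> real) \<Rightarrow> 'n::{finite,linorder} rmat" where
  "block_diag k a = (\<chi> i j. if i = j then a (block k i) else 0)"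

definition phi4 ::
  "nat \<Rightarrow> (nat \<Rightarrow> nat) \<Rightarrow> (nat \<Rightarrow> real) \<Rightarrow> 'n::{finite,linorder} rmat \<Rightarrow> nat \<Rightarrow> 'n rvec set" where
  "phi4 p k a X = (THE F. \<exists>Q. rotation_matrix Q \<and> X = Q ** block_diag k a ** transpose Q \<and>
     F = column_flag p k Q)"

end

theory Submission
  imports Defs
begin

text \<open>
  A symmetric matrix with spectrum \<open>a\<^sub>1, \<dots>, a\<^sub>p\<^sub>+\<^sub>1\<close> and prescribed multiplicities is the same thing as an
  orthogonal decomposition of \<open>\<real>\<^sup>n\<close> into labelled eigenspaces, and such a decomposition is the same
  thing as the flag of its partial sums.  The orthogonal projections \<open>\<pi>\<^sub>j\<close> onto the members of the flag
  mediate between the two sides, because both directions are explicit formulas in them: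
  \<open>X = \<Sum>\<^sub>j a\<^sub>j (\<pi>\<^sub>j - \<pi>\<^sub>j\<^sub>-\<^sub>1)\<close>, and conversely \<open>\<pi>\<^sub>j = q\<^sub>j(X)\<close> for a polynomial \<open>q\<^sub>j\<close> that
  interpolates the step function \<open>a\<^sub>l \<mapsto> [l \<le> j]\<close>.  This gives well-definedness and injectivity
  (\<open>spectral_matrix_eq_iff\<close>); surjectivity holds since every flag has an adapted orthonormal basis
  (\<open>flag_has_rotation\<close>).

  For smoothness, each cell of the flag manifold is carried over to the isospectral model.  If the flag
  is spanned by the leading columns of an invertible \<open>A = g (1 + N)\<close>, and \<open>E\<close> is the coordinate projection
  to the first \<open>k\<^sub>j\<close> coordinates, then \<open>\<pi>\<^sub>j = A E H\<^sup>-\<^sup>1 E A\<^sup>T\<close> with \<open>H = E A\<^sup>T A E + (1 - E)\<close>, which is smooth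
  in \<open>N\<close>.  In the other direction \<open>1 + N\<close> is the unique matrix whose columns in the \<open>j\<close>-th block lie in
  \<open>g\<^sup>-\<^sup>1\<close> of the \<open>j\<close>-th member of the flag and project under \<open>E\<close> to the standard basis vectors; with
  \<open>R = g\<^sup>-\<^sup>1 \<pi>\<^sub>j\<close> those columns are the ones of \<open>R R\<^sup>T E H\<^sup>-\<^sup>1 E\<close> for \<open>H = E R R\<^sup>T E + (1 - E)\<close>.  The cell consists
  precisely of the \<open>X\<close> for which all these \<open>H\<close> are invertible (\<open>cell_coord\<close>, \<open>cell_in_domain\<close>).  So it is
  open, the two formulas are mutually inverse smooth maps, and the big-cell chart becomes a submanifold
  chart of the isospectral model (\<open>cell_chart_pulled_back\<close>).

  Nothing else about the flag atlas has to be computed.  Its transition maps, its topology, the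
  Hausdorff property and second countability are inherited from the submanifold along the bijection
  (\<open>diffeomorphism_from_submanifold\<close>).
\<close>

section \<open>Calculus of smooth maps\<close>

lemma hdiff_on_const: "higher_differentiable_on W (\<lambda>x. c) m"
  by (induction m arbitrary: c) auto

lemma hdiff_on_cong:
  assumes "open W" "\<And>x. x \<in> W \<Longrightarrow> f x = g x" "higher_differentiable_on W f m"
  shows "higher_differentiable_on W g m"
  using assms(2,3)
proof (induction m arbitrary: f g)
  case 0
  then show ?case using continuous_on_cong by fastforce
next
  case (Suc m)
  have D: "(g has_derivative frechet_derivative f (at x)) (at x)" if "x \<in> W" for x
    using has_derivative_transform_within_open[OF _ \<open>open W\<close> that, of f _ UNIV g] Suc.prems that
    by (auto simp: frechet_derivative_works)
  have "higher_differentiable_on W (\<lambda>x. frechet_derivative g (at x) v) m" for v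
    using Suc.IH[of "\<lambda>x. frechet_derivative f (at x) v" "\<lambda>x. frechet_derivative g (at x) v"]
      Suc.prems frechet_derivative_at[OF D] by auto
  then show ?case using D by (auto simp: differentiable_def)
qed

text \<open>
  Derivatives computed by hand may replace the Frechet derivative chosen by the definition, since on an
  open set it is unique.  The induction steps below all have this form.
\<close>

lemma hdiff_on_SucI:
  assumes "open W" "\<And>x. x \<in> W \<Longrightarrow> (f has_derivative f' x) (at x)"
    and "\<And>v. higher_differentiable_on W (\<lambda>x. f' x v) m"
  shows "higher_differentiable_on W f (Suc m)"
proof -
  have "higher_differentiable_on W (\<lambda>x. frechet_derivative f (at x) v) m" for v
    by (rule hdiff_on_cong[OF assms(1) _ assms(3)]) (simp add: fun_cong[OF frechet_derivative_at[OF assms(2)]])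
  then show ?thesis using assms(2) by (auto simp: differentiable_def)
qed

lemma hdiff_on_SucD:
  assumes "higher_differentiable_on W f (Suc m)"
  shows "x \<in> W \<Longrightarrow> (f has_derivative frechet_derivative f (at x)) (at x)"
    and "higher_differentiable_on W (\<lambda>x. frechet_derivative f (at x) v) m"
  using assms by (auto simp: frechet_derivative_works)

lemma hdiff_on_Suc_imp: "higher_differentiable_on W f (Suc m) \<Longrightarrow> higher_differentiable_on W f m"
proof (induction m arbitrary: f)
  case 0
  then show ?case
    by (auto intro!: continuous_at_imp_continuous_on differentiable_imp_continuous_within)
qed auto

lemma hdiff_on_continuous_on: "higher_differentiable_on W f m \<Longrightarrow> continuous_on W f"
  by (induction m) (use hdiff_on_Suc_imp in auto)

lemma hdiff_on_subset:
  "higher_differentiable_on W f m \<Longrightarrow> V \<subseteq> W \<Longrightarrow> higher_differentiable_on V f m"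
  by (induction m arbitrary: f) (auto intro: continuous_on_subset)

lemma hdiff_on_linear:
  assumes "open W" "bounded_linear L" "higher_differentiable_on W f m"
  shows "higher_differentiable_on W (\<lambda>x. L (f x)) m"
  using assms(3)
proof (induction m arbitrary: f)
  case 0
  then show ?case using bounded_linear.continuous_on[OF assms(2)] by auto
next
  case (Suc m)
  show ?case
    by (rule hdiff_on_SucI[OF assms(1) bounded_linear.has_derivative[OF assms(2) hdiff_on_SucD(1)[OF Suc.prems]]])
      (auto intro: Suc.IH hdiff_on_SucD(2)[OF Suc.prems])
qed

lemma hdiff_on_id: "open W \<Longrightarrow> higher_differentiable_on W (\<lambda>x. x) m"
  by (cases m) (auto intro!: continuous_intros hdiff_on_const)

lemma hdiff_on_add:
  assumes "open W" "higher_differentiable_on W f m" "higher_differentiable_on W g m"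
  shows "higher_differentiable_on W (\<lambda>x. f x + g x) m"
  using assms(2,3)
proof (induction m arbitrary: f g)
  case 0
  then show ?case by (auto intro: continuous_intros)
next
  case (Suc m)
  show ?case
    by (rule hdiff_on_SucI[OF assms(1) has_derivative_add[OF hdiff_on_SucD(1)[OF Suc.prems(1)] hdiff_on_SucD(1)[OF Suc.prems(2)]]])
      (auto intro: Suc.IH hdiff_on_SucD(2)[OF Suc.prems(1)] hdiff_on_SucD(2)[OF Suc.prems(2)])
qed

lemma hdiff_on_diff:
  assumes "open W" "higher_differentiable_on W f m" "higher_differentiable_on W g m"
  shows "higher_differentiable_on W (\<lambda>x. f x - g x) m"
  using hdiff_on_add[OF assms(1,2) hdiff_on_linear[OF assms(1) bounded_linear_minus[OF bounded_linear_ident] assms(3)]] by simp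

lemma hdiff_on_scaleR:
  assumes "open W" "higher_differentiable_on W f m"
  shows "higher_differentiable_on W (\<lambda>x. c *\<^sub>R f x) m"
  by (rule hdiff_on_linear[OF assms(1) bounded_linear_scaleR_right assms(2)])

lemma hdiff_on_bilinear:
  assumes "open W" "bounded_bilinear B"
    "higher_differentiable_on W f m" "higher_differentiable_on W g m"
  shows "higher_differentiable_on W (\<lambda>x. B (f x) (g x)) m"
  using assms(3,4)
proof (induction m arbitrary: f g)
  case 0
  then show ?case using bounded_bilinear.continuous_on[OF assms(2)] by auto
next
  case (Suc m)
  show ?case
    by (rule hdiff_on_SucI[OF assms(1) bounded_bilinear.FDERIV[OF assms(2) hdiff_on_SucD(1)[OF Suc.prems(1)] hdiff_on_SucD(1)[OF Suc.prems(2)]]], assumption, assumption)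
      (rule hdiff_on_add[OF assms(1) Suc.IH[OF hdiff_on_Suc_imp[OF Suc.prems(1)] hdiff_on_SucD(2)[OF Suc.prems(2)]]
          Suc.IH[OF hdiff_on_SucD(2)[OF Suc.prems(1)] hdiff_on_Suc_imp[OF Suc.prems(2)]]])
qed

lemma hdiff_on_sum:
  assumes "open W" "\<And>i. i \<in> I \<Longrightarrow> higher_differentiable_on W (f i) m"
  shows "higher_differentiable_on W (\<lambda>x. \<Sum>i\<in>I. f i x) m"
  using assms(2)
  by (induction I rule: infinite_finite_induct) (auto intro!: hdiff_on_const hdiff_on_add[OF assms(1)])

text \<open>
  Expanding \<open>g'(f x)\<close> in an orthonormal basis writes the derivative of \<open>g \<circ> f\<close> as a sum of products of a
  derivative of \<open>f\<close> and a composite \<open>(\<partial>\<^sub>b g) \<circ> f\<close> with a fixed direction \<open>b\<close>.  The induction hypothesis for all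
  \<open>g\<close> applies to the latter, so no higher chain rule is needed.
\<close>

lemma hdiff_on_compose:
  fixes f :: "'a::real_normed_vector \<Rightarrow> 'b::euclidean_space"
    and g :: "'b \<Rightarrow> 'c::real_normed_vector"
  assumes "open W" "f ` W \<subseteq> V"
    and "higher_differentiable_on W f m" "higher_differentiable_on V g m"
  shows "higher_differentiable_on W (\<lambda>x. g (f x)) m"
  using assms(3,4)
proof (induction m arbitrary: g)
  case 0
  then show ?case using assms(2) by (auto intro: continuous_on_compose2)
next
  case (Suc m)
  let ?Df = "\<lambda>x. frechet_derivative f (at x)"
  let ?Dg = "\<lambda>y. frechet_derivative g (at y)"
  have D: "((\<lambda>x. g (f x)) has_derivative (\<lambda>v. \<Sum>b\<in>Basis. (?Df x v \<bullet> b) *\<^sub>R ?Dg (f x) b)) (at x)"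
    if "x \<in> W" for x
  proof -
    have g: "(g has_derivative ?Dg (f x)) (at (f x))"
      using hdiff_on_SucD(1)[OF Suc.prems(2)] assms(2) that by blast
    have "?Dg (f x) w = (\<Sum>b\<in>Basis. (w \<bullet> b) *\<^sub>R ?Dg (f x) b)" for w
    proof -
      have "?Dg (f x) w = ?Dg (f x) (\<Sum>b\<in>Basis. (w \<bullet> b) *\<^sub>R b)"
        by (simp add: euclidean_representation)
      also have "\<dots> = (\<Sum>b\<in>Basis. (w \<bullet> b) *\<^sub>R ?Dg (f x) b)"
        using has_derivative_linear[OF g] by (simp add: linear_sum linear_scale)
      finally show ?thesis .
    qed
    then show ?thesis
      by (intro has_derivative_eq_rhs[OF has_derivative_compose[OF hdiff_on_SucD(1)[OF Suc.prems(1) that] g]] ext)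
  qed
  show ?case
  proof (rule hdiff_on_SucI[OF assms(1) D])
    fix v
    have 1: "higher_differentiable_on W (\<lambda>x. ?Df x v \<bullet> b) m" for b
      by (rule hdiff_on_linear[OF assms(1) bounded_linear_inner_left hdiff_on_SucD(2)[OF Suc.prems(1)]])
    have 2: "higher_differentiable_on W (\<lambda>x. ?Dg (f x) b) m" for b
      by (rule Suc.IH[OF hdiff_on_Suc_imp[OF Suc.prems(1)] hdiff_on_SucD(2)[OF Suc.prems(2)]])
    show "higher_differentiable_on W (\<lambda>x. \<Sum>b\<in>Basis. (?Df x v \<bullet> b) *\<^sub>R ?Dg (f x) b) m"
      by (intro hdiff_on_sum[OF assms(1)] hdiff_on_bilinear[OF assms(1) bounded_bilinear_scaleR] 1 2)
  qed
qed

lemma smooth_onI: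
  assumes "\<And>x. x \<in> A \<Longrightarrow> open (W x)" "\<And>x. x \<in> A \<Longrightarrow> x \<in> W x"
    and "\<And>x m. x \<in> A \<Longrightarrow> higher_differentiable_on (W x) (g x) m"
    and "\<And>x y. x \<in> A \<Longrightarrow> y \<in> W x \<Longrightarrow> y \<in> A \<Longrightarrow> g x y = f y"
  shows "smooth_on A f"
  unfolding smooth_on_def
proof
  fix x assume "x \<in> A"
  then show "\<exists>W g. open W \<and> x \<in> W \<and> (\<forall>m. higher_differentiable_on W g m) \<and> (\<forall>y\<in>W \<inter> A. g y = f y)"
    by (intro exI[of _ "W x"] exI[of _ "g x"] conjI allI ballI assms) auto
qed

lemma smooth_onE:
  assumes "smooth_on A f" "x \<in> A"
  obtains W g where "open W" "x \<in> W" "\<forall>m. higher_differentiable_on W g m"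
    "\<forall>y\<in>W \<inter> A. g y = f y"
proof -
  have "\<exists>W g. open W \<and> x \<in> W \<and> (\<forall>m. higher_differentiable_on W g m) \<and> (\<forall>y\<in>W \<inter> A. g y = f y)"
    using assms unfolding smooth_on_def by (rule bspec)
  then show thesis by (elim exE conjE) (rule that)
qed

lemma smooth_on_cong_subset:
  assumes f: "smooth_on A f" and "B \<subseteq> A" and eq: "\<And>x. x \<in> B \<Longrightarrow> f x = g x"
  shows "smooth_on B g"
  unfolding smooth_on_def
proof
  fix x assume "x \<in> B"
  with \<open>B \<subseteq> A\<close> have "x \<in> A" by auto
  obtain W h where "open W" "x \<in> W" "\<forall>m. higher_differentiable_on W h m"
    and h: "\<forall>y\<in>W \<inter> A. h y = f y"
    by (rule smooth_onE[OF f \<open>x \<in> A\<close>])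
  moreover have "\<forall>y\<in>W \<inter> B. h y = g y" using h eq \<open>B \<subseteq> A\<close> by auto
  ultimately show "\<exists>W h. open W \<and> x \<in> W \<and> (\<forall>m. higher_differentiable_on W h m) \<and> (\<forall>y\<in>W \<inter> B. h y = g y)"
    by (intro exI[of _ W] exI[of _ h] conjI) assumption+
qed

lemma smooth_on_continuous_on:
  assumes "smooth_on A f"
  shows "continuous_on A f"
  unfolding continuous_on_def
proof
  fix x assume "x \<in> A"
  obtain W g where W: "open W" "x \<in> W" "\<forall>m. higher_differentiable_on W g m"
    and eq: "\<forall>y\<in>W \<inter> A. g y = f y"
    by (rule smooth_onE[OF assms \<open>x \<in> A\<close>])
  have "(g \<longlongrightarrow> g x) (at x within A)"
    using hdiff_on_continuous_on[OF W(3)[rule_format]] W(1,2)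
    by (simp add: continuous_on_eq_continuous_at isCont_def Lim_at_imp_Lim_at_within)
  moreover have "\<forall>\<^sub>F y in at x within A. g y = f y"
    unfolding eventually_at_topological using W(1,2) eq by (intro exI[of _ W]) auto
  ultimately show "(f \<longlongrightarrow> f x) (at x within A)"
    using bspec[OF eq, of x] W(2) \<open>x \<in> A\<close> by (auto intro: Lim_transform_eventually)
qed

lemma smooth_on_compose:
  fixes f :: "'a::real_normed_vector \<Rightarrow> 'b::euclidean_space"
    and g :: "'b \<Rightarrow> 'c::real_normed_vector"
  assumes f: "smooth_on A f" and g: "smooth_on B g" and "f ` A \<subseteq> B"
  shows "smooth_on A (g \<circ> f)"
  unfolding smooth_on_def
proof
  fix x assume "x \<in> A"
  obtain W F where W: "open W" "x \<in> W" "\<forall>m. higher_differentiable_on W F m"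
    and F: "\<forall>y\<in>W \<inter> A. F y = f y"
    by (rule smooth_onE[OF f \<open>x \<in> A\<close>])
  have "f x \<in> B" using \<open>x \<in> A\<close> assms(3) by auto
  obtain V G where V: "open V" "f x \<in> V" "\<forall>m. higher_differentiable_on V G m"
    and G: "\<forall>y\<in>V \<inter> B. G y = g y"
    by (rule smooth_onE[OF g \<open>f x \<in> B\<close>])
  \<comment> \<open>the local extension of \<open>f\<close> may leave the domain of that of \<open>g\<close>, so its domain is shrunk\<close>
  define U where "U = W \<inter> F -` V"
  have "open U"
    unfolding U_def using continuous_open_preimage[OF hdiff_on_continuous_on[OF W(3)[rule_format]] W(1) V(1)] .
  moreover have "x \<in> U" using W V F \<open>x \<in> A\<close> by (simp add: U_def)
  moreover have "higher_differentiable_on U (\<lambda>y. G (F y)) m" for m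
    by (rule hdiff_on_compose[OF \<open>open U\<close> _ hdiff_on_subset[OF W(3)[rule_format]] V(3)[rule_format]]) (auto simp: U_def)
  moreover have "\<forall>y\<in>U \<inter> A. G (F y) = (g \<circ> f) y"
  proof
    fix y assume y: "y \<in> U \<inter> A"
    then have "F y = f y" "F y \<in> V" using F by (auto simp: U_def)
    then show "G (F y) = (g \<circ> f) y" using G y \<open>f ` A \<subseteq> B\<close> by auto
  qed
  ultimately show "\<exists>W h. open W \<and> x \<in> W \<and> (\<forall>m. higher_differentiable_on W h m) \<and>
      (\<forall>y\<in>W \<inter> A. h y = (g \<circ> f) y)"
    by (intro exI[of _ U] exI[of _ "\<lambda>y. G (F y)"] conjI allI) assumption+
qed

section \<open>Smoothness of matrix operations\<close>

lemma bounded_bilinear_matrix_mul: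
  "bounded_bilinear ((**) :: real^'n^'m \<Rightarrow> real^'k^'n \<Rightarrow> real^'k^'m)"
  unfolding bilinear_conv_bounded_bilinear[symmetric] bilinear_def
  by (auto intro!: linearI simp: matrix_matrix_mult_def vec_eq_iff sum.distrib sum_distrib_left algebra_simps)

lemmas matrix_add_rdistrib = bounded_bilinear.add_left[OF bounded_bilinear_matrix_mul]
lemmas matrix_diff_ldistrib = bounded_bilinear.diff_right[OF bounded_bilinear_matrix_mul]
lemmas matrix_diff_rdistrib = bounded_bilinear.diff_left[OF bounded_bilinear_matrix_mul]
lemmas matrix_sum_ldistrib = bounded_bilinear.sum_right[OF bounded_bilinear_matrix_mul]
lemmas matrix_sum_rdistrib = bounded_bilinear.sum_left[OF bounded_bilinear_matrix_mul]

lemma hdiff_on_matrix_mul: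
  assumes "open W" "higher_differentiable_on W f m" "higher_differentiable_on W g m"
  shows "higher_differentiable_on W (\<lambda>x. (f x :: real^'n^'m) ** (g x :: real^'k^'n)) m"
  by (rule hdiff_on_bilinear[OF assms(1) bounded_bilinear_matrix_mul assms(2,3)])

lemma continuous_on_det:
  fixes f :: "'a::topological_space \<Rightarrow> real^'n^'n"
  assumes "continuous_on W f"
  shows "continuous_on W (\<lambda>x. det (f x))"
  unfolding det_def by (intro continuous_intros assms)

lemma open_invertible: "open {A :: real^'n^'n. invertible A}"
proof -
  have "open (det -` (- {0::real}) :: (real^'n^'n) set)"
    using continuous_on_det[OF continuous_on_id, of UNIV]
    by (intro open_vimage) auto
  moreover have "det -` (- {0::real}) = {A :: real^'n^'n. invertible A}"
    by (auto simp: invertible_det_nz)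
  ultimately show ?thesis by simp
qed

lemma open_invertible_preimage:
  fixes f :: "'z::topological_space \<Rightarrow> real^'i^'i"
  assumes "continuous_on UNIV f"
  shows "open {x. invertible (f x)}"
  using open_vimage[OF open_invertible assms] by (simp add: vimage_def)

lemma matrix_inv_mul:
  fixes A :: "real^'n^'n"
  assumes "invertible A"
  shows "A ** matrix_inv A = mat 1" "matrix_inv A ** A = mat 1"
  using someI_ex[OF assms[unfolded invertible_def]] by (auto simp: matrix_inv_def)

text \<open>
  The entries of the numerators in Cramer's rule, where the condition tells whether the column has been
  replaced.
\<close>

lemma continuous_on_entry:
  "continuous_on W (\<lambda>A :: real^'n^'m. if P then c else A $ i $ j)"
  by (cases P) (auto intro!: continuous_intros)

lemma continuous_on_matrix_inv:
  "continuous_on {A :: real^'n^'n. invertible A} matrix_inv"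
proof -
  let ?c = "\<lambda>A i j. det (\<chi> r c. if c = i then axis j 1 $ r else A $ r $ c) / det A"
  have eq: "matrix_inv A = (\<chi> i j. ?c A i j)" if "invertible A" for A :: "real^'n^'n"
  proof -
    have "A *v (matrix_inv A *v axis j 1) = axis j 1" for j
      by (simp add: matrix_vector_mul_assoc matrix_inv_mul[OF that])
    then have "matrix_inv A *v axis j 1 = (\<chi> i. ?c A i j)" for j
      using that cramer[of A] by (simp add: invertible_det_nz)
    moreover have "(matrix_inv A *v axis j 1) $ i = matrix_inv A $ i $ j" for i j
      by (simp add: matrix_vector_mult_basis column_def)
    ultimately show ?thesis by (simp add: vec_eq_iff)
  qed
  have "continuous_on {A :: real^'n^'n. invertible A} (\<lambda>A. \<chi> i j. ?c A i j)"
    by (intro continuous_on_vec_lambda continuous_on_divide continuous_on_det)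
      (auto simp: invertible_det_nz if_distrib[of "continuous_on _"] cong: if_cong
        intro!: continuous_intros continuous_on_entry)
  then show ?thesis
    by (rule continuous_on_eq) (use eq in auto)
qed

text \<open>
  The resolvent identity \<open>B\<^sup>-\<^sup>1 - A\<^sup>-\<^sup>1 = - B\<^sup>-\<^sup>1 (B - A) A\<^sup>-\<^sup>1\<close> reduces differentiability of the inverse to its
  continuity, which comes from Cramer's rule.
\<close>

lemma has_derivative_matrix_inv:
  fixes A :: "real^'n^'n"
  assumes "invertible A"
  shows "(matrix_inv has_derivative (\<lambda>H. - (matrix_inv A ** H ** matrix_inv A))) (at A)"
proof -
  let ?I = "matrix_inv A"
  obtain K where "0 < K" and K: "\<And>(B :: real^'n^'n) (C :: real^'n^'n). norm (B ** C) \<le> norm B * norm C * K"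
    using bounded_bilinear.pos_bounded[OF bounded_bilinear_matrix_mul] by blast
  have bl: "bounded_linear (\<lambda>H. - (?I ** H ** ?I))"
    by (intro bounded_linear_minus bounded_linear_compose[OF bounded_bilinear.bounded_linear_left[OF bounded_bilinear_matrix_mul]]
        bounded_bilinear.bounded_linear_right[OF bounded_bilinear_matrix_mul])
  have "isCont matrix_inv A"
    using continuous_on_matrix_inv[where 'n='n] assms
    unfolding continuous_on_eq_continuous_at[OF open_invertible] by blast
  then have lim: "((\<lambda>B. norm (matrix_inv B - ?I) * (K * norm ?I * K)) \<longlongrightarrow> 0) (at A)"
    by (intro tendsto_mult_left_zero tendsto_norm_zero) (simp add: isCont_def LIM_zero)
  have ev: "\<forall>\<^sub>F B in at A. invertible B"
    unfolding eventually_at_topological using open_invertible assms by blast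
  have bound: "norm (norm (matrix_inv B - ?I - - (?I ** (B - A) ** ?I)) / norm (B - A))
      \<le> norm (matrix_inv B - ?I) * (K * norm ?I * K)" if "invertible B" for B
  proof -
    have 1: "matrix_inv B ** B ** ?I = ?I" "matrix_inv B ** A ** ?I = matrix_inv B"
       "?I ** A ** ?I = ?I"
      by (simp_all add: matrix_inv_mul that assms matrix_mul_assoc[symmetric])
    have "matrix_inv B - ?I - - (?I ** (B - A) ** ?I) = - ((matrix_inv B - ?I) ** (B - A) ** ?I)"
      by (simp add: matrix_diff_ldistrib matrix_diff_rdistrib 1)
    also have "norm \<dots> \<le> norm ((matrix_inv B - ?I) ** (B - A)) * norm ?I * K"
      using K[of "(matrix_inv B - ?I) ** (B - A)" ?I] by simp
    also have "\<dots> \<le> (norm (matrix_inv B - ?I) * norm (B - A) * K) * norm ?I * K"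
      using K[of "matrix_inv B - ?I" "B - A"] \<open>0 < K\<close> by (intro mult_right_mono) auto
    finally show ?thesis
      by (cases "B = A") (auto simp: divide_simps algebra_simps intro: mult_nonneg_nonneg less_imp_le \<open>0 < K\<close>)
  qed
  show ?thesis
    unfolding has_derivative_iff_norm
    by (intro conjI bl Lim_null_comparison[OF eventually_mono[OF ev bound] lim])
qed

text \<open>
  The derivative \<open>- f\<^sup>-\<^sup>1 (f' v) f\<^sup>-\<^sup>1\<close> contains only one derivative of \<open>f\<close> and the inverse itself, so the order of
  differentiability grows by one at each step.
\<close>

lemma hdiff_on_matrix_inv:
  fixes f :: "'a::real_normed_vector \<Rightarrow> real^'n^'n"
  assumes W: "open W" "\<And>x. x \<in> W \<Longrightarrow> invertible (f x)" and "higher_differentiable_on W f m"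
  shows "higher_differentiable_on W (\<lambda>x. matrix_inv (f x)) m"
  using assms(3)
proof (induction m)
  case 0
  then show ?case
    using continuous_on_compose2[OF continuous_on_matrix_inv] W(2) by fastforce
next
  case (Suc m)
  have IH: "higher_differentiable_on W (\<lambda>x. matrix_inv (f x)) m"
    using Suc hdiff_on_Suc_imp by blast
  have D: "((\<lambda>x. matrix_inv (f x)) has_derivative
      (\<lambda>v. - (matrix_inv (f x) ** frechet_derivative f (at x) v ** matrix_inv (f x)))) (at x)"
    if "x \<in> W" for x
    by (rule has_derivative_compose[OF hdiff_on_SucD(1)[OF Suc.prems that] has_derivative_matrix_inv[OF W(2)[OF that]]])
  show ?case
    by (rule hdiff_on_SucI[OF W(1) D], assumption)
      (intro hdiff_on_linear[OF W(1) bounded_linear_minus[OF bounded_linear_ident]] hdiff_on_matrix_mul[OF W(1)]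
        IH hdiff_on_SucD(2)[OF Suc.prems])
qed

lemma bounded_linear_transpose: "bounded_linear (transpose :: real^'n^'m \<Rightarrow> real^'m^'n)"
  unfolding linear_conv_bounded_linear[symmetric]
  by (intro linearI) (auto simp: transpose_def vec_eq_iff)

lemma hdiff_on_transpose:
  "open W \<Longrightarrow> higher_differentiable_on W f m \<Longrightarrow> higher_differentiable_on W (\<lambda>x. transpose (f x :: real^'i^'j)) m"
  by (rule hdiff_on_linear[OF _ bounded_linear_transpose])

section \<open>Submanifold charts and their transport along a bijection\<close>

lemma submanifold_atlasD:
  assumes "(U, \<phi>) \<in> submanifold_atlas S"
  shows "openin (top_of_set S) U" "inj_on \<phi> U" "smooth_on U \<phi>" "smooth_on (\<phi> ` U) (inv_into U \<phi>)"
    "\<exists>E. subspace E \<and> openin (top_of_set E) (\<phi> ` U)" "U \<subseteq> S"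
  using assms by (auto simp: submanifold_atlas_def dest: openin_imp_subset)

lemma submanifold_chart_homeomorphism:
  assumes "(U, \<phi>) \<in> submanifold_atlas S"
  shows "homeomorphism U (\<phi> ` U) \<phi> (inv_into U \<phi>)"
  using submanifold_atlasD[OF assms]
  by (intro homeomorphismI smooth_on_continuous_on) (auto simp: inv_into_into)

lemma submanifold_chart_openin_iff:
  assumes "(U, \<phi>) \<in> submanifold_atlas S"
  shows "openin (top_of_set (\<phi> ` U)) (\<phi> ` (U \<inter> W)) \<longleftrightarrow> openin (top_of_set S) (U \<inter> W)"
proof -
  note hom = submanifold_chart_homeomorphism[OF assms]
  have "openin (top_of_set (\<phi> ` U)) (\<phi> ` (U \<inter> W)) \<longleftrightarrow> openin (top_of_set U) (U \<inter> W)"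
  proof
    assume "openin (top_of_set (\<phi> ` U)) (\<phi> ` (U \<inter> W))"
    then have "openin (top_of_set U) (inv_into U \<phi> ` \<phi> ` (U \<inter> W))"
      by (rule homeomorphism_imp_open_map[OF homeomorphism_symD[OF hom]])
    then show "openin (top_of_set U) (U \<inter> W)"
      using submanifold_atlasD(2)[OF assms] by simp
  qed (rule homeomorphism_imp_open_map[OF hom])
  also have "\<dots> \<longleftrightarrow> openin (top_of_set S) (U \<inter> W)"
    using submanifold_atlasD(1,6)[OF assms]
    by (metis inf_le1 openin_subset_trans openin_trans)
  finally show ?thesis .
qed

text \<open>
  Submanifold charts are homeomorphisms between relatively open sets, so any covering family of them
  generates the subspace topology.
\<close>

lemma atlas_topology_submanifold:
  assumes C: "C \<subseteq> submanifold_atlas S" and cover: "(\<Union>(U, \<phi>)\<in>C. U) = S"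
  shows "atlas_topology S C = top_of_set S"
proof (rule topology_eq[THEN iffD2], rule allI)
  fix W
  have inj: "inj_on \<phi> U" if "(U, \<phi>) \<in> C" for U \<phi>
    using that C submanifold_atlasD(2) by blast
  have "openin (atlas_topology S C) W \<longleftrightarrow>
      W \<subseteq> S \<and> (\<forall>(U, \<phi>)\<in>C. openin (top_of_set (\<phi> ` U)) (\<phi> ` (U \<inter> W)))"
    by (rule openin_atlas_topology[OF inj])
  also have "\<dots> \<longleftrightarrow> W \<subseteq> S \<and> (\<forall>(U, \<phi>)\<in>C. openin (top_of_set S) (U \<inter> W))"
    using C by (intro conj_cong refl ball_cong) (auto simp: submanifold_chart_openin_iff)
  also have "\<dots> \<longleftrightarrow> openin (top_of_set S) W"
  proof
    assume W: "W \<subseteq> S \<and> (\<forall>(U, \<phi>)\<in>C. openin (top_of_set S) (U \<inter> W))"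
    then have "openin (top_of_set S) (\<Union>(U, \<phi>)\<in>C. U \<inter> W)"
      by (intro openin_Union) (auto simp del: openin_Int)
    moreover have "(\<Union>(U, \<phi>)\<in>C. U \<inter> W) = (\<Union>(U, \<phi>)\<in>C. U) \<inter> W" by auto
    moreover have "\<dots> = W" using W unfolding cover by auto
    ultimately show "openin (top_of_set S) W" by simp
  next
    assume W: "openin (top_of_set S) W"
    have "openin (top_of_set S) (U \<inter> W)" if "(U, \<phi>) \<in> C" for U \<phi>
      using that C submanifold_atlasD(1) W by blast
    then show "W \<subseteq> S \<and> (\<forall>(U, \<phi>)\<in>C. openin (top_of_set S) (U \<inter> W))"
      using openin_imp_subset[OF W] by auto
  qed
  finally show "openin (atlas_topology S C) W \<longleftrightarrow> openin (top_of_set S) W" .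
qed

lemma submanifold_transition:
  assumes U: "(U, \<phi>) \<in> submanifold_atlas S" and V: "(V, \<psi>) \<in> submanifold_atlas S"
  shows "openin (top_of_set (\<phi> ` U)) (\<phi> ` (U \<inter> V))"
    and "smooth_on (\<phi> ` (U \<inter> V)) (\<psi> \<circ> inv_into U \<phi>)"
proof -
  show "openin (top_of_set (\<phi> ` U)) (\<phi> ` (U \<inter> V))"
    unfolding submanifold_chart_openin_iff[OF U]
    using submanifold_atlasD(1)[OF U] submanifold_atlasD(1)[OF V] by blast
  have "smooth_on (\<phi> ` (U \<inter> V)) (inv_into U \<phi>)"
    by (rule smooth_on_cong_subset[OF submanifold_atlasD(4)[OF U]]) auto
  then show "smooth_on (\<phi> ` (U \<inter> V)) (\<psi> \<circ> inv_into U \<phi>)"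
    by (rule smooth_on_compose[OF _ submanifold_atlasD(3)[OF V]])
      (use submanifold_atlasD(2)[OF U] in auto)
qed

lemma smooth_manifold_submanifold:
  assumes C: "C \<subseteq> submanifold_atlas S" and cover: "(\<Union>(U, \<phi>)\<in>C. U) = S"
    and dim: "\<And>U \<phi>. (U, \<phi>) \<in> C \<Longrightarrow> \<exists>E. subspace E \<and> dim E = d \<and> openin (top_of_set E) (\<phi> ` U)"
  shows "smooth_manifold S C"
  unfolding smooth_manifold_def atlas_topology_submanifold[OF C cover]
proof (intro conjI)
  show "smooth_atlas S C"
    unfolding smooth_atlas_def
  proof (intro conjI exI[of _ d] cover)
    show "\<forall>(U, \<phi>)\<in>C. inj_on \<phi> U \<and> (\<exists>E. subspace E \<and> dim E = d \<and> openin (top_of_set E) (\<phi> ` U))"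
      using C dim submanifold_atlasD(2) by blast
    show "\<forall>(U, \<phi>)\<in>C. \<forall>(V, \<psi>)\<in>C. openin (top_of_set (\<phi> ` U)) (\<phi> ` (U \<inter> V)) \<and>
        smooth_on (\<phi> ` (U \<inter> V)) (\<psi> \<circ> inv_into U \<phi>)"
    proof (intro ballI, clarify, intro conjI)
      fix U \<phi> V \<psi> assume "(U, \<phi>) \<in> C" "(V, \<psi>) \<in> C"
      then have *: "(U, \<phi>) \<in> submanifold_atlas S" "(V, \<psi>) \<in> submanifold_atlas S"
        using C by auto
      show "openin (top_of_set (\<phi> ` U)) (\<phi> ` (U \<inter> V))" "smooth_on (\<phi> ` (U \<inter> V)) (\<psi> \<circ> inv_into U \<phi>)"
        using submanifold_transition[OF *] .
    qed
  qed
  show "Hausdorff_space (top_of_set S)"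
    by (simp add: Hausdorff_space_subtopology)
  show "second_countable (top_of_set S)"
  proof (rule second_countable_subtopology)
    obtain B :: "'a set set" where B: "countable B" "topological_basis B"
      using ex_countable_basis by blast
    show "second_countable (euclidean :: 'a topology)"
      unfolding second_countable_def
      using B topological_basis_open[OF B(2)] topological_basisE[OF B(2)]
      by (intro exI[of _ B]) (simp, metis)
  qed
qed

text \<open>
  The definition of the submanifold atlas does not fix the dimension of its charts; invariance of
  dimension forces it to be constant along overlaps.
\<close>

lemma submanifold_charts_same_dim:
  assumes U: "(U, \<phi>) \<in> submanifold_atlas S" and V: "(V, \<psi>) \<in> submanifold_atlas S"
    and ne: "U \<inter> V \<noteq> {}"
    and E: "subspace E" "openin (top_of_set E) (\<phi> ` U)"
    and F: "subspace F" "openin (top_of_set F) (\<psi> ` V)"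
  shows "dim E \<le> dim F"
proof (rule invariance_of_dimension_subspaces)
  show "openin (top_of_set E) (\<phi> ` (U \<inter> V))"
    using submanifold_transition(1)[OF U V] E(2) openin_trans by blast
  show "continuous_on (\<phi> ` (U \<inter> V)) (\<psi> \<circ> inv_into U \<phi>)"
    using submanifold_transition(2)[OF U V] smooth_on_continuous_on by blast
  show "\<psi> \<circ> inv_into U \<phi> \<in> \<phi> ` (U \<inter> V) \<rightarrow> F"
    using submanifold_atlasD(2)[OF U] openin_imp_subset[OF F(2)] by auto
  show "inj_on (\<psi> \<circ> inv_into U \<phi>) (\<phi> ` (U \<inter> V))"
    using submanifold_atlasD(2)[OF U] submanifold_atlasD(2)[OF V]
    by (auto intro!: inj_onI dest: inj_onD)
qed (use E F ne in auto)

text \<open>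
  Every chart with nonempty domain meets a chart of the covering family \<open>C\<close> and so has dimension \<open>d\<close>.  The
  empty chart is open in any subspace, and the bound on \<open>d\<close> provides one of the right dimension.
\<close>

lemma smooth_manifold_submanifold_atlas:
  assumes C: "C \<subseteq> submanifold_atlas S" and cover: "(\<Union>(U, \<phi>)\<in>C. U) = S"
    and dim: "\<And>U \<phi>. (U, \<phi>) \<in> C \<Longrightarrow> \<exists>E. subspace E \<and> dim E = d \<and> openin (top_of_set E) (\<phi> ` U)"
    and "d \<le> DIM('e)"
  shows "smooth_manifold S (submanifold_atlas (S :: 'e::euclidean_space set))"
proof (rule smooth_manifold_submanifold)
  show "(\<Union>(U, \<phi>)\<in>submanifold_atlas S. U) = S"
  proof
    show "(\<Union>(U, \<phi>)\<in>submanifold_atlas S. U) \<subseteq> S"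
      using submanifold_atlasD(6) by fast
    show "S \<subseteq> (\<Union>(U, \<phi>)\<in>submanifold_atlas S. U)"
      using C cover by blast
  qed
  fix U \<phi> assume U: "(U, \<phi>) \<in> submanifold_atlas S"
  show "\<exists>E. subspace E \<and> dim E = d \<and> openin (top_of_set E) (\<phi> ` U)"
  proof (cases "U = {}")
    case True
    obtain E :: "'e set" where "subspace E" "dim E = d"
      using choose_subspace_of_subspace[of d "UNIV :: 'e set"] \<open>d \<le> DIM('e)\<close> by auto
    then show ?thesis using True by auto
  next
    case False
    obtain E where E: "subspace E" "openin (top_of_set E) (\<phi> ` U)"
      using submanifold_atlasD(5)[OF U] by blast
    obtain x where "x \<in> U" using False by auto
    then have "x \<in> (\<Union>(U, \<phi>)\<in>C. U)" using submanifold_atlasD(6)[OF U] cover by auto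
    then obtain V \<psi> where V: "(V, \<psi>) \<in> C" "x \<in> V" by auto
    obtain F where F: "subspace F" "dim F = d" "openin (top_of_set F) (\<psi> ` V)"
      using dim[OF V(1)] by auto
    have V': "(V, \<psi>) \<in> submanifold_atlas S" using V(1) C by auto
    have "U \<inter> V \<noteq> {}" "V \<inter> U \<noteq> {}" using V(2) \<open>x \<in> U\<close> by auto
    then have "dim E = d"
      using submanifold_charts_same_dim[OF U V' _ E F(1,3)]
        submanifold_charts_same_dim[OF V' U _ F(1,3) E] F(2) by simp
    then show ?thesis using E by blast
  qed
qed simp

text \<open>
  If the charts of an atlas on a bare set \<open>T\<close> pull back along a bijection to submanifold charts of \<open>S\<close>, then
  the two atlases differ only by relabelling points, and all properties of \<open>S\<close> pass to \<open>T\<close>.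
\<close>

lemma diffeomorphism_from_submanifold:
  fixes S :: "'e::euclidean_space set" and \<B> :: "('b, 'e) chart set"
  assumes f: "bij_betw f S T"
    and cover: "(\<Union>(V, \<psi>)\<in>\<B>. V) = T"
    and dim: "\<And>V \<psi>. (V, \<psi>) \<in> \<B> \<Longrightarrow> \<exists>E. subspace E \<and> dim E = d \<and> openin (top_of_set E) (\<psi> ` V)"
    and "d \<le> DIM('e)"
    and pull: "\<And>V \<psi>. (V, \<psi>) \<in> \<B> \<Longrightarrow> (S \<inter> f -` V, \<psi> \<circ> f) \<in> submanifold_atlas S"
  shows "diffeomorphism S (submanifold_atlas S) T \<B> f"
proof -
  let ?p = "\<lambda>(V, \<psi>). (S \<inter> f -` V, \<psi> \<circ> f)"
  define C where "C = ?p ` \<B>"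
  define g where "g = inv_into S f"
  have gf: "g (f x) = x" if "x \<in> S" for x
    using f that by (simp add: g_def bij_betw_def)
  have fg: "f (g y) = y" "g y \<in> S" if "y \<in> T" for y
    using f that by (auto simp: g_def bij_betw_def f_inv_into_f inv_into_into)
  have fS: "f x \<in> T" if "x \<in> S" for x using f that by (auto simp: bij_betw_def)
  have VT: "V \<subseteq> T" if "(V, \<psi>) \<in> \<B>" for V \<psi> using that cover by auto
  have fU: "f ` (S \<inter> f -` V \<inter> A) = V \<inter> g -` A" if "(V, \<psi>) \<in> \<B>" for V \<psi> A
    using VT[OF that] fg gf by force
  have fU': "f ` (S \<inter> f -` V) = V" if "(V, \<psi>) \<in> \<B>" for V \<psi>
    using fU[OF that, of UNIV] by simp
  have im: "(\<psi> \<circ> f) ` (S \<inter> f -` V) = \<psi> ` V" if "(V, \<psi>) \<in> \<B>" for V \<psi>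
    using fU'[OF that] by (metis image_comp)
  have inj: "inj_on \<psi> V" if "(V, \<psi>) \<in> \<B>" for V \<psi>
    using submanifold_atlasD(2)[OF pull[OF that]] fU'[OF that] by (metis inj_on_imageI)
  have inv: "g (inv_into V \<psi> y) = inv_into (S \<inter> f -` V) (\<psi> \<circ> f) y"
    if V: "(V, \<psi>) \<in> \<B>" and y: "y \<in> \<psi> ` V" for V \<psi> y
  proof -
    obtain v where v: "v \<in> V" "y = \<psi> v" using y by auto
    then have gv: "g v \<in> S \<inter> f -` V" using fg[of v] VT[OF V] by auto
    have "inv_into V \<psi> y = v" using v inj[OF V] by simp
    moreover have "inv_into (S \<inter> f -` V) (\<psi> \<circ> f) y = g v"
      using inv_into_f_f[OF submanifold_atlasD(2)[OF pull[OF V]] gv] v fg(1)[of v] VT[OF V]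
      by auto
    ultimately show ?thesis by simp
  qed
  have C: "C \<subseteq> submanifold_atlas S" using pull by (auto simp: C_def)
  have coverC: "(\<Union>(U, \<phi>)\<in>C. U) = S"
    using cover fS by (fastforce simp: C_def)
  have dimC: "\<exists>E. subspace E \<and> dim E = d \<and> openin (top_of_set E) (\<phi> ` U)" if "(U, \<phi>) \<in> C" for U \<phi>
    using that dim im by (auto simp: C_def simp del: comp_apply)
  note manC = smooth_manifold_submanifold[OF C coverC dimC]
  note manS = smooth_manifold_submanifold_atlas[OF C coverC dimC \<open>d \<le> DIM('e)\<close>]
  have topS: "atlas_topology S (submanifold_atlas S) = top_of_set S"
    by (rule atlas_topology_submanifold) (use manS in \<open>auto simp: smooth_manifold_def smooth_atlas_def\<close>)
  have openT: "openin (atlas_topology T \<B>) W \<longleftrightarrow>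
      W \<subseteq> T \<and> (\<forall>(V, \<psi>)\<in>\<B>. openin (top_of_set (\<psi> ` V)) (\<psi> ` (V \<inter> W)))" for W
    by (rule openin_atlas_topology[OF inj])
  have opT: "openin (atlas_topology T \<B>) W \<longleftrightarrow> openin (top_of_set S) (S \<inter> f -` W)" if "W \<subseteq> T" for W
  proof -
    have eq: "(\<psi> \<circ> f) ` (S \<inter> f -` V \<inter> (S \<inter> f -` W)) = \<psi> ` (V \<inter> W)" if "(V, \<psi>) \<in> \<B>" for V \<psi>
    proof -
      have "f ` (S \<inter> f -` V \<inter> (S \<inter> f -` W)) = V \<inter> W"
        unfolding fU[OF that] using VT[OF that] fg by auto
      then show ?thesis by (metis image_comp)
    qed
    have injC: "inj_on \<phi> U" if "(U, \<phi>) \<in> C" for U \<phi>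
      using that C submanifold_atlasD(2) by blast
    have "openin (atlas_topology S C) (S \<inter> f -` W) \<longleftrightarrow> S \<inter> f -` W \<subseteq> S \<and>
        (\<forall>(U, \<phi>)\<in>C. openin (top_of_set (\<phi> ` U)) (\<phi> ` (U \<inter> (S \<inter> f -` W))))"
      by (rule openin_atlas_topology[OF injC])
    also have "\<dots> \<longleftrightarrow> (\<forall>x\<in>\<B>. case ?p x of (U, \<phi>) \<Rightarrow> openin (top_of_set (\<phi> ` U)) (\<phi> ` (U \<inter> (S \<inter> f -` W))))"
      by (simp add: C_def)
    also have "\<dots> \<longleftrightarrow> (\<forall>(V, \<psi>)\<in>\<B>. openin (top_of_set (\<psi> ` V)) (\<psi> ` (V \<inter> W)))"
    proof (intro ball_cong refl)
      fix x assume "x \<in> \<B>"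
      then show "(case ?p x of (U, \<phi>) \<Rightarrow> openin (top_of_set (\<phi> ` U)) (\<phi> ` (U \<inter> (S \<inter> f -` W)))) \<longleftrightarrow>
          (case x of (V, \<psi>) \<Rightarrow> openin (top_of_set (\<psi> ` V)) (\<psi> ` (V \<inter> W)))"
        by (cases x) (simp only: prod.case eq im)
    qed
    finally show ?thesis
      using \<open>W \<subseteq> T\<close> by (simp add: openT atlas_topology_submanifold[OF C coverC])
  qed
  have topsp: "topspace (atlas_topology T \<B>) = T"
  proof
    show "topspace (atlas_topology T \<B>) \<subseteq> T"
      using openT openin_topspace by blast
    have "S \<inter> f -` T = S" using fS by auto
    then show "T \<subseteq> topspace (atlas_topology T \<B>)"
      using opT[of T] by (intro openin_subset) simp
  qed
  have hom: "homeomorphic_map (top_of_set S) (atlas_topology T \<B>) f"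
    unfolding homeomorphic_map_def quotient_map_def topsp
    using f opT by (auto simp: bij_betw_def vimage_def Int_def)
  then have homs: "top_of_set S homeomorphic_space atlas_topology T \<B>"
    by (rule homeomorphic_map_imp_homeomorphic_space)
  have transT: "openin (top_of_set (\<phi> ` U)) (\<phi> ` (U \<inter> V)) \<and>
      smooth_on (\<phi> ` (U \<inter> V)) (\<psi> \<circ> inv_into U \<phi>)" if U: "(U, \<phi>) \<in> \<B>" and V: "(V, \<psi>) \<in> \<B>" for U \<phi> V \<psi>
  proof -
    have eq: "(\<phi> \<circ> f) ` ((S \<inter> f -` U) \<inter> (S \<inter> f -` V)) = \<phi> ` (U \<inter> V)"
    proof -
      have "f ` ((S \<inter> f -` U) \<inter> (S \<inter> f -` V)) = U \<inter> V"
        unfolding fU[OF U] using VT[OF U] fg by auto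
      then show ?thesis by (metis image_comp)
    qed
    note tr = submanifold_transition[OF pull[OF U] pull[OF V], unfolded eq im[OF U]]
    have "smooth_on (\<phi> ` (U \<inter> V)) (\<psi> \<circ> inv_into U \<phi>)"
    proof (rule smooth_on_cong_subset[OF tr(2) order_refl])
      fix y assume "y \<in> \<phi> ` (U \<inter> V)"
      then obtain u where u: "u \<in> U" "y = \<phi> u" by auto
      then show "(\<psi> \<circ> f \<circ> inv_into (S \<inter> f -` U) (\<phi> \<circ> f)) y = (\<psi> \<circ> inv_into U \<phi>) y"
        using inv[OF U, of y] inj[OF U] fg(1)[of u] VT[OF U] by (auto simp del: comp_apply simp: comp_def)
    qed
    then show ?thesis using tr(1) by simp
  qed
  have "smooth_manifold T \<B>"
    unfolding smooth_manifold_def smooth_atlas_def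
  proof (intro conjI exI[of _ d])
    show "Hausdorff_space (atlas_topology T \<B>)"
      using homeomorphic_Hausdorff_space[OF homs] by (simp add: Hausdorff_space_subtopology)
    show "second_countable (atlas_topology T \<B>)"
      using homeomorphic_space_second_countability[OF homs] manC
      by (simp add: smooth_manifold_def atlas_topology_submanifold[OF C coverC])
    show "\<forall>(U, \<phi>)\<in>\<B>. \<forall>(V, \<psi>)\<in>\<B>. openin (top_of_set (\<phi> ` U)) (\<phi> ` (U \<inter> V)) \<and>
        smooth_on (\<phi> ` (U \<inter> V)) (\<psi> \<circ> inv_into U \<phi>)"
      using transT by blast
    show "\<forall>(U, \<phi>)\<in>\<B>. inj_on \<phi> U \<and> (\<exists>E. subspace E \<and> dim E = d \<and> openin (top_of_set E) (\<phi> ` U))"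
      using inj dim by blast
  qed (rule cover)
  moreover have "smooth_map S (submanifold_atlas S) T \<B> f"
    unfolding smooth_map_def topS
  proof (intro conjI ballI, rule homeomorphic_imp_continuous_map[OF hom], clarify)
    fix U \<phi> V \<psi> assume U: "(U, \<phi>) \<in> submanifold_atlas S" and V: "(V, \<psi>) \<in> \<B>"
    have "U \<inter> (S \<inter> f -` V) = U \<inter> f -` V" using submanifold_atlasD(6)[OF U] by auto
    then show "smooth_on (\<phi> ` (U \<inter> f -` V)) (\<psi> \<circ> f \<circ> inv_into U \<phi>)"
      using submanifold_transition(2)[OF U pull[OF V]] by simp
  qed
  moreover have "smooth_map T \<B> S (submanifold_atlas S) g"
    unfolding smooth_map_def topS
  proof (intro conjI ballI, goal_cases)
    case 1
    show ?case
      unfolding continuous_map_def topsp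
    proof (intro conjI allI impI)
      show "g \<in> T \<rightarrow> topspace (top_of_set S)" using fg by auto
      fix W assume W: "openin (top_of_set S) W"
      have "S \<inter> f -` {y \<in> T. g y \<in> W} = W"
        using openin_imp_subset[OF W] gf fS by auto
      then show "openin (atlas_topology T \<B>) {y \<in> T. g y \<in> W}"
        using opT[of "{y \<in> T. g y \<in> W}"] W by auto
    qed
  next
    case (2 c)
    show ?case
    proof (clarify)
      fix V \<psi> U \<phi> assume c: "c = (V, \<psi>)" and U: "(U, \<phi>) \<in> submanifold_atlas S"
      then have V: "(V, \<psi>) \<in> \<B>" using 2 by simp
      have eq: "(\<psi> \<circ> f) ` (S \<inter> f -` V \<inter> U) = \<psi> ` (V \<inter> g -` U)"
        using fU[OF V] by (metis image_comp)
      show "smooth_on (\<psi> ` (V \<inter> g -` U)) (\<phi> \<circ> g \<circ> inv_into V \<psi>)"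
      proof (rule smooth_on_cong_subset[OF submanifold_transition(2)[OF pull[OF V] U]])
        fix y assume "y \<in> \<psi> ` (V \<inter> g -` U)"
        then show "(\<phi> \<circ> inv_into (S \<inter> f -` V) (\<psi> \<circ> f)) y = (\<phi> \<circ> g \<circ> inv_into V \<psi>) y"
          using inv[OF V, of y] by auto
      qed (simp add: eq del: comp_apply)
    qed
  qed
  ultimately show ?thesis
    unfolding diffeomorphism_def using manS f by (simp add: g_def)
qed

section \<open>Diagonal matrices and column spaces\<close>

definition diag_mat :: "('n \<Rightarrow> real) \<Rightarrow> real^'n^'n" where
  "diag_mat d = (\<chi> i j. if i = j then d i else 0)"

lemma matrix_mul_diag_mat: "(A ** diag_mat d) $ i $ j = A $ i $ j * d j"
  by (simp add: matrix_matrix_mult_def diag_mat_def if_distrib sum.delta cong: if_cong)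

lemma diag_mat_matrix_mul: "(diag_mat d ** A) $ i $ j = d i * A $ i $ j"
  by (simp add: matrix_matrix_mult_def diag_mat_def if_distrib[of "\<lambda>x. x * _"] sum.delta cong: if_cong)

lemma diag_mat_mul: "diag_mat d ** diag_mat e = diag_mat (\<lambda>i. d i * e i)"
  by (simp add: vec_eq_iff matrix_mul_diag_mat) (simp add: diag_mat_def)

lemma transpose_diag_mat: "transpose (diag_mat d) = diag_mat d"
  by (simp add: vec_eq_iff transpose_def diag_mat_def)

lemma mat_eq_diag_mat: "mat c = diag_mat (\<lambda>_. c)"
  by (simp add: vec_eq_iff mat_def diag_mat_def)

lemma diag_mat_diff: "diag_mat d - diag_mat e = diag_mat (\<lambda>i. d i - e i)"
  by (simp add: vec_eq_iff diag_mat_def)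

lemma diag_mat_scaleR: "c *\<^sub>R diag_mat d = diag_mat (\<lambda>i. c * d i)"
  by (simp add: vec_eq_iff diag_mat_def)

lemma diag_mat_sum: "(\<Sum>j\<in>J. diag_mat (d j)) = diag_mat (\<lambda>i. \<Sum>j\<in>J. d j i)"
  by (simp add: vec_eq_iff diag_mat_def)

lemma diag_mat_mul_vec: "(diag_mat d *v x) $ i = d i * x $ i"
  by (simp add: matrix_vector_mult_def diag_mat_def if_distrib[of "\<lambda>x. x * _"] sum.delta cong: if_cong)

lemma trace_diag_mat: "trace (diag_mat d) = (\<Sum>i\<in>UNIV. d i)"
  by (simp add: trace_def diag_mat_def)

lemma inner_matrix_vector: "(A *v x) \<bullet> y = x \<bullet> (transpose A *v y)" for A :: "real^'n^'m"
  by (metis dot_lmul_matrix inner_commute transpose_matrix_vector)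

definition colspace :: "real^'n^'m \<Rightarrow> (real^'m) set" where
  "colspace M = range ((*v) M)"

lemma colspace_mul_subset: "colspace (A ** B) \<subseteq> colspace A"
  by (auto simp: colspace_def matrix_vector_mul_assoc[symmetric])

lemma subspace_colspace: "subspace (colspace M)"
  unfolding colspace_def by (intro linear_subspace_image subspace_UNIV matrix_vector_mul_linear)

lemma column_in_colspace: "column i M \<in> colspace M" for M :: "real^'n^'m"
  unfolding colspace_def matrix_vector_mult_basis[symmetric] by blast

lemma colspace_subsetI:
  fixes M :: "real^'n^'m"
  assumes "subspace V" "\<And>i. column i M \<in> V"
  shows "colspace M \<subseteq> V"
  using assms by (auto simp: colspace_def matrix_mult_sum scalar_mult_eq_scaleR
      intro!: subspace_sum subspace_scale)

lemma fix_colspace: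
  assumes "P ** N = N" "colspace M \<subseteq> colspace N"
  shows "P ** M = M"
proof (rule matrix_eq[THEN iffD2], rule allI)
  fix x
  obtain y where "M *v x = N *v y" using assms(2) by (auto simp: colspace_def)
  then show "P ** M *v x = M *v x"
    by (metis assms(1) matrix_vector_mul_assoc)
qed

text \<open>
  Equal column spaces give \<open>P' P = P\<close> and \<open>P P' = P'\<close>, and transposing one of these equations identifies
  \<open>P\<close> with \<open>P'\<close>.
\<close>

lemma orthogonal_projection_unique:
  fixes P P' :: "real^'n^'n"
  assumes P: "transpose P = P" "P ** P = P" and P': "transpose P' = P'" "P' ** P' = P'"
    and eq: "colspace P = colspace P'"
  shows "P = P'"
proof -
  have "P' ** P = P" "P ** P' = P'"
    using fix_colspace[OF P'(2), of P] fix_colspace[OF P(2), of P'] eq by auto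
  then show ?thesis using P(1) P'(1) by (metis matrix_transpose_mul)
qed

lemma span_leading_columns:
  fixes Q :: "real^'n^'m"
  shows "span {column i Q |i. P i} = colspace (Q ** diag_mat (\<lambda>i. of_bool (P i)))" (is "_ = colspace ?M")
proof
  have col: "column i ?M = of_bool (P i) *\<^sub>R column i Q" for i
    by (simp add: column_def vec_eq_iff matrix_mul_diag_mat)
  show "colspace ?M \<subseteq> span {column i Q |i. P i}"
    by (rule colspace_subsetI) (auto simp: col intro: span_base span_zero)
  show "span {column i Q |i. P i} \<subseteq> colspace ?M"
  proof (rule span_minimal[OF _ subspace_colspace], clarify)
    fix i assume "P i"
    then show "column i Q \<in> colspace ?M" using column_in_colspace[of i ?M] by (simp add: col)
  qed
qed

lemma column_mul: "column c (A ** B) = A *v column c B" for A B :: "real^'n^'n"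
  by (simp add: matrix_vector_mult_basis[symmetric] matrix_vector_mul_assoc)

lemma invertible_kernel:
  fixes A :: "real^'n^'n"
  assumes "\<And>x. A *v x = 0 \<Longrightarrow> x = 0"
  shows "invertible A"
  using assms by (simp add: invertible_left_inverse matrix_left_invertible_ker)

lemma dim_colspace_invertible_mul:
  fixes A :: "real^'n^'n"
  assumes "invertible A"
  shows "dim (colspace (A ** B)) = dim (colspace B)"
proof -
  have "colspace (A ** B) = (*v) A ` colspace B"
    by (auto simp: colspace_def matrix_vector_mul_assoc[symmetric])
  moreover have "inj ((*v) A)" using inj_matrix_vector_mult[OF assms] .
  ultimately show ?thesis
    by (simp add: dim_image_eq inj_on_subset)
qed

lemma dim_colspace_diag_indicator:
  "dim (colspace (diag_mat (\<lambda>i. of_bool (P i)) :: real^'n^'n)) = card {i. P i}"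
proof -
  have "colspace (diag_mat (\<lambda>i. of_bool (P i)) :: real^'n^'n) = {x. \<forall>i. i \<notin> {i. P i} \<longrightarrow> x $ i = 0}" (is "colspace ?E = ?V")
  proof
    show "colspace ?E \<subseteq> ?V" by (auto simp: colspace_def diag_mat_mul_vec)
    have "x \<in> colspace ?E" if "x \<in> ?V" for x
    proof -
      have "x = ?E *v x" using that by (auto simp: vec_eq_iff diag_mat_mul_vec)
      then show ?thesis unfolding colspace_def by blast
    qed
    then show "?V \<subseteq> colspace ?E" by blast
  qed
  then show ?thesis by (simp only: dim_vec_eq[symmetric] dim_substandard_cart)
qed

section \<open>Compressed Gram matrices\<close>

text \<open>
  The compression of \<open>K\<close> to the range of the projection \<open>E\<close>, extended by the identity on the kernel of \<open>E\<close>
  in order to stay a square matrix of full size, so that inverting it is a smooth operation.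
\<close>

definition compress :: "real^'n^'n \<Rightarrow> real^'n^'n \<Rightarrow> real^'n^'n" where
  "compress E K = E ** K ** E + (mat 1 - E)"

text \<open>
  The quadratic form of this matrix at \<open>x\<close> is \<open>|R\<^sup>T E x|\<^sup>2 + |x - E x|\<^sup>2\<close>.  If it vanishes, then \<open>x = E x = E R Y x\<close> and
  hence \<open>|x|\<^sup>2 = (R\<^sup>T E x) \<bullet> (Y x) = 0\<close>.  The hypothesis on \<open>Y\<close> says that \<open>E R\<close> maps onto the range of \<open>E\<close>.
\<close>

lemma invertible_compress:
  fixes E R :: "real^'n^'n"
  assumes E: "E ** E = E" "transpose E = E" and Y: "E ** R ** Y = E"
  shows "invertible (compress E (R ** transpose R))"
proof (rule invertible_kernel)
  fix x assume 0: "compress E (R ** transpose R) *v x = 0"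
  let ?v = "transpose R *v (E *v x)" and ?w = "x - E *v x"
  have Ew: "E *v ?w = 0"
    by (simp add: matrix_vector_mult_diff_distrib matrix_vector_mul_assoc E)
  have "0 = x \<bullet> (compress E (R ** transpose R) *v x)" using 0 by simp
  also have "\<dots> = x \<bullet> (E *v (R *v ?v)) + x \<bullet> ?w"
    by (simp add: compress_def matrix_vector_mult_add_rdistrib matrix_vector_mult_diff_rdistrib
        matrix_vector_mul_assoc[symmetric] inner_add_right del: transpose_matrix_vector)
  also have "x \<bullet> (E *v (R *v ?v)) = ?v \<bullet> ?v"
    by (metis E(2) inner_commute inner_matrix_vector transpose_transpose)
  also have "x \<bullet> ?w = ?w \<bullet> ?w"
  proof -
    have "(E *v x) \<bullet> ?w = 0" by (simp only: inner_matrix_vector E(2) Ew inner_zero_right)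
    then show ?thesis by (simp add: inner_diff_left)
  qed
  finally have "?v \<bullet> ?v + ?w \<bullet> ?w = 0" by simp
  then have v: "?v = 0" and w: "E *v x = x"
    using inner_ge_zero[of ?v] inner_ge_zero[of ?w] by (metis add_nonneg_eq_0_iff inner_eq_zero_iff, metis add_nonneg_eq_0_iff inner_eq_zero_iff eq_iff_diff_eq_0)
  have "x \<bullet> x = x \<bullet> (E *v (R *v (Y *v x)))"
    using w Y by (simp add: matrix_vector_mul_assoc matrix_mul_assoc)
  also have "\<dots> = ?v \<bullet> (Y *v x)"
    by (metis E(2) inner_commute inner_matrix_vector transpose_transpose)
  finally show "x = 0" using v by simp
qed

lemma compress_commute:
  assumes "E ** E = E"
  shows "compress E K ** E = E ** K ** E" "E ** compress E K = E ** K ** E"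
proof -
  show "compress E K ** E = E ** K ** E"
    by (simp add: compress_def matrix_add_rdistrib matrix_diff_rdistrib matrix_mul_assoc[symmetric] assms)
  show "E ** compress E K = E ** K ** E"
    by (simp add: compress_def matrix_add_ldistrib matrix_diff_ldistrib matrix_mul_assoc assms)
qed

lemma compress_inverse:
  assumes E: "E ** E = E" and inv: "invertible (compress E K)"
  shows "E ** K ** E ** matrix_inv (compress E K) = E" "matrix_inv (compress E K) ** (E ** K ** E) = E"
proof -
  let ?H = "compress E K"
  have "E ** ?H ** matrix_inv ?H = E" "matrix_inv ?H ** (?H ** E) = E"
    by (simp add: matrix_mul_assoc[symmetric] matrix_inv_mul[OF inv],
        simp add: matrix_mul_assoc matrix_inv_mul[OF inv])
  then show "E ** K ** E ** matrix_inv ?H = E" "matrix_inv ?H ** (E ** K ** E) = E"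
    by (simp_all add: compress_commute[OF E])
qed

lemma hdiff_on_compress:
  "open W \<Longrightarrow> higher_differentiable_on W f m \<Longrightarrow> higher_differentiable_on W (\<lambda>x. compress E (f x)) m"
  unfolding compress_def by (intro hdiff_on_add hdiff_on_matrix_mul hdiff_on_const)

lemma transpose_matrix_inv:
  fixes H :: "real^'n^'n"
  assumes "invertible H" "transpose H = H"
  shows "transpose (matrix_inv H) = matrix_inv H"
proof -
  have "transpose (matrix_inv H) ** H = mat 1"
    using matrix_inv_mul(1)[OF assms(1)] assms(2) by (metis matrix_transpose_mul transpose_mat)
  then show ?thesis
    by (metis matrix_inv_mul(1)[OF assms(1)] matrix_mul_assoc matrix_mul_lid matrix_mul_rid)
qed

text \<open>
  The orthogonal projection onto the column space of \<open>A E\<close>, as given by the normal equations.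
\<close>

definition image_projection :: "real^'n^'n \<Rightarrow> real^'n^'n \<Rightarrow> real^'n^'n" where
  "image_projection E A = A ** E ** matrix_inv (compress E (transpose A ** A)) ** E ** transpose A"

lemma transpose_add: "transpose (A + B) = transpose A + transpose B"
  by (simp add: transpose_def vec_eq_iff)

lemma transpose_diff: "transpose (A - B) = transpose A - transpose B"
  by (simp add: transpose_def vec_eq_iff)

lemma invertible_compress_gram:
  fixes A :: "real^'n^'n"
  assumes A: "invertible A" and E: "E ** E = E" "transpose E = E"
  shows "invertible (compress E (transpose A ** A))"
proof -
  have "transpose A ** transpose (matrix_inv A) = mat 1"
    by (metis matrix_inv_mul(2)[OF A] matrix_transpose_mul transpose_mat)
  then have "E ** transpose A ** transpose (matrix_inv A) = E"
    by (simp add: matrix_mul_assoc[symmetric])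
  then show ?thesis using invertible_compress[OF E, of "transpose A"] by simp
qed

lemma image_projection:
  fixes A :: "real^'n^'n"
  assumes A: "invertible A" and E: "E ** E = E" "transpose E = E"
  shows "transpose (image_projection E A) = image_projection E A"
    and "image_projection E A ** image_projection E A = image_projection E A"
    and "colspace (image_projection E A) = colspace (A ** E)"
proof -
  let ?H = "compress E (transpose A ** A)" and ?P = "image_projection E A"
  note inv = invertible_compress_gram[OF assms]
  have "transpose ?H = ?H"
    by (simp add: compress_def transpose_add transpose_diff matrix_transpose_mul E matrix_mul_assoc transpose_mat)
  then show "transpose ?P = ?P"
    using transpose_matrix_inv[OF inv]
    by (simp add: image_projection_def matrix_transpose_mul E matrix_mul_assoc)
  have absorb: "?P ** (A ** E) = A ** E"
  proof -
    have "?P ** (A ** E) = A ** E ** (matrix_inv ?H ** (E ** (transpose A ** A) ** E))"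
      by (simp add: image_projection_def matrix_mul_assoc)
    also have "\<dots> = A ** E ** E" by (simp only: compress_inverse(2)[OF E(1) inv])
    also have "\<dots> = A ** E" by (simp add: matrix_mul_assoc[symmetric] E)
    finally show ?thesis .
  qed
  have fac: "?P = A ** E ** (matrix_inv ?H ** E ** transpose A)"
    by (simp add: image_projection_def matrix_mul_assoc)
  show "?P ** ?P = ?P"
    by (metis fac absorb matrix_mul_assoc)
  show "colspace ?P = colspace (A ** E)"
  proof
    show "colspace ?P \<subseteq> colspace (A ** E)" by (subst fac) (rule colspace_mul_subset)
    show "colspace (A ** E) \<subseteq> colspace ?P"
      using colspace_mul_subset[of ?P "A ** E"] by (simp only: absorb)
  qed
qed

lemma invertible_orthogonal: "orthogonal_matrix Q \<Longrightarrow> invertible Q" for Q :: "real^'n^'n"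
  unfolding orthogonal_matrix_def invertible_def by blast

lemma orthogonal_conj_projection:
  fixes Q :: "real^'n^'n"
  assumes Q: "orthogonal_matrix Q" and E: "E ** E = E" "transpose E = E"
  shows "transpose (Q ** E ** transpose Q) = Q ** E ** transpose Q"
    and "(Q ** E ** transpose Q) ** (Q ** E ** transpose Q) = Q ** E ** transpose Q"
    and "colspace (Q ** E ** transpose Q) = colspace (Q ** E)"
proof -
  let ?P = "Q ** E ** transpose Q"
  have QQ: "transpose Q ** Q = mat 1" using Q by (simp add: orthogonal_matrix)
  show "transpose ?P = ?P" by (simp add: matrix_transpose_mul E matrix_mul_assoc)
  have absorb: "?P ** (Q ** E) = Q ** E"
    by (metis QQ E(1) matrix_mul_assoc matrix_mul_rid)
  then show "?P ** ?P = ?P" by (simp add: matrix_mul_assoc)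
  show "colspace ?P = colspace (Q ** E)"
    using colspace_mul_subset[of "Q ** E" "transpose Q"] colspace_mul_subset[of ?P "Q ** E"] absorb by simp
qed

section \<open>Blocks of indices and flags of leading columns\<close>

lemma position_less_iff: "position i < position j \<longleftrightarrow> i < (j :: 'n::{finite,linorder})"
proof -
  have *: "position x < position y" if "x < y" for x y :: 'n
    unfolding position_def by (rule psubset_card_mono) (use that in auto)
  then show ?thesis by (metis less_asym linorder_cases)
qed

lemma bij_betw_position: "bij_betw position (UNIV :: 'n::{finite,linorder} set) {..<CARD('n)}"
proof -
  have inj: "inj (position :: 'n \<Rightarrow> nat)"
    by (metis injI linorder_neqE position_less_iff less_irrefl)
  moreover have "range (position :: 'n \<Rightarrow> nat) \<subseteq> {..<CARD('n)}"
    unfolding position_def by (auto intro!: psubset_card_mono)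
  ultimately show ?thesis
    by (simp add: bij_betw_def card_image card_subset_eq)
qed

lemma card_position_less:
  assumes "m \<le> CARD('n)"
  shows "card {i :: 'n::{finite,linorder}. position i < m} = m"
proof -
  have "bij_betw position {i :: 'n. position i < m} {..<m}"
    using bij_betw_subset[OF bij_betw_position[where 'n='n], of "{i. position i < m}" "{..<m}"]
      bij_betw_imp_surj_on[OF bij_betw_position[where 'n='n]] assms
    by (auto simp: image_def set_eq_iff) (metis lessThan_iff less_le_trans)
  then show ?thesis using bij_betw_same_card by fastforce
qed

definition leading :: "(nat \<Rightarrow> nat) \<Rightarrow> nat \<Rightarrow> 'n::{finite,linorder} rmat" where
  "leading k j = diag_mat (\<lambda>i. of_bool (position i < k j))"

lemma leading_idem: "leading k j ** leading k j = leading k j"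
  by (simp add: leading_def diag_mat_mul of_bool_conj[symmetric])

lemma transpose_leading: "transpose (leading k j) = leading k j"
  by (simp add: leading_def transpose_diag_mat)

lemma column_flag_nth:
  "j \<in> {1..p} \<Longrightarrow> column_flag p k Q j = colspace (Q ** leading k j)"
  by (simp add: column_flag_def leading_def span_leading_columns)

lemma column_flag_eqI:
  assumes "\<And>j. j \<in> {1..p} \<Longrightarrow> colspace (A ** leading k j) = colspace (B ** leading k j)"
  shows "column_flag p k A = column_flag p k B"
proof
  fix j show "column_flag p k A j = column_flag p k B j"
    by (cases "j \<in> {1..p}") (simp only: column_flag_nth assms, auto simp: column_flag_def)
qed

locale flag_dims =
  fixes p :: nat and k :: "nat \<Rightarrow> nat" and index_type :: "'n::{finite,linorder} itself"
  assumes k_zero: "k 0 = 0"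
    and k_step: "\<And>j. j \<le> p \<Longrightarrow> k j < k (Suc j)"
    and k_last: "k (Suc p) = CARD('n)"
begin

lemma k_mono: "i \<le> j \<Longrightarrow> j \<le> Suc p \<Longrightarrow> k i \<le> k j"
proof (induction j rule: dec_induct)
  case (step j)
  then show ?case using k_step[of j] by simp
qed simp

lemma k_le_card: "j \<le> Suc p \<Longrightarrow> k j \<le> CARD('n)"
  using k_mono[of j "Suc p"] k_last by simp

lemma position_less_card: "position (i :: 'n) < CARD('n)"
  using bij_betw_apply[OF bij_betw_position[where 'n='n], of i] by simp

lemma block_le_iff:
  assumes "j \<le> Suc p"
  shows "block k (i :: 'n) \<le> j \<longleftrightarrow> position i < k j"
proof
  assume "block k i \<le> j"
  moreover have "position i < k (block k i)"
    unfolding block_def by (rule LeastI[of _ "Suc p"]) (simp add: position_less_card k_last)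
  ultimately show "position i < k j" using k_mono[of "block k i" j] assms by simp
next
  assume "position i < k j"
  then show "block k i \<le> j" unfolding block_def by (rule Least_le)
qed

lemma block_range: "block k (i :: 'n) \<in> {1..Suc p}"
  using block_le_iff[of 0 i] block_le_iff[of "Suc p" i] k_zero k_last position_less_card[of i]
  by (auto simp: Suc_le_eq)

lemma leading_block: "j \<le> Suc p \<Longrightarrow> (leading k j :: 'n rmat) = diag_mat (\<lambda>i. of_bool (block k i \<le> j))"
  by (simp add: leading_def block_le_iff)

lemma card_block: "j \<in> {1..Suc p} \<Longrightarrow> card {i :: 'n. block k i = j} = k j - k (j - 1)"
proof -
  assume j: "j \<in> {1..Suc p}"
  have "block k i = j \<longleftrightarrow> position i < k j \<and> \<not> position i < k (j - 1)" for i :: 'n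
  proof -
    have "block k i = j \<longleftrightarrow> block k i \<le> j \<and> \<not> block k i \<le> j - 1" using j by auto
    moreover have "j \<le> Suc p" "j - 1 \<le> Suc p" using j by auto
    ultimately show ?thesis by (simp only: block_le_iff)
  qed
  then have "{i :: 'n. block k i = j} = {i. position i < k j} - {i. position i < k (j - 1)}"
    by auto
  also have "card \<dots> = k j - k (j - 1)"
    using j k_mono[of "j - 1" j] k_le_card[of j] k_le_card[of "j - 1"]
    by (subst card_Diff_subset) (auto simp: card_position_less)
  finally show ?thesis .
qed

lemma leading_mul: "l \<le> j \<Longrightarrow> j \<le> Suc p \<Longrightarrow> (leading k j :: 'n rmat) ** leading k l = leading k l"
  by (simp add: leading_block diag_mat_mul) (auto simp: of_bool_def intro!: arg_cong[of _ _ diag_mat])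

lemma leading_last: "(leading k (Suc p) :: 'n rmat) = mat 1"
  using block_range by (simp add: leading_block mat_eq_diag_mat)

lemma leading_zero: "(leading k 0 :: 'n rmat) = 0"
  by (simp add: leading_def k_zero diag_mat_def vec_eq_iff)

lemma sum_blocks:
  "(\<Sum>j=1..Suc p. M j ** (leading k j - leading k (j - 1))) $ r $ c = M (block k (c :: 'n)) $ r $ c"
    for M :: "nat \<Rightarrow> 'n rmat"
proof -
  have "(\<Sum>j=1..Suc p. M j ** (leading k j - leading k (j - 1))) $ r $ c
      = (\<Sum>j=1..Suc p. M j $ r $ c * (of_bool (block k c \<le> j) - of_bool (block k c \<le> j - 1)))"
  proof -
    have "(M j ** (leading k j - leading k (j - 1))) $ r $ c
        = M j $ r $ c * (of_bool (block k c \<le> j) - of_bool (block k c \<le> j - 1))" if "j \<in> {1..Suc p}" for j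
    proof -
      have "j \<le> Suc p" "j - 1 \<le> Suc p" using that by auto
      then show ?thesis by (simp only: leading_block diag_mat_diff matrix_mul_diag_mat)
    qed
    then show ?thesis unfolding sum_component by (rule sum.cong[OF refl])
  qed
  also have "\<dots> = (\<Sum>j=1..Suc p. if j = block k c then M j $ r $ c else 0)"
    by (intro sum.cong refl) (auto simp: of_bool_def)
  also have "\<dots> = M (block k c) $ r $ c"
    using block_range[of c] by simp
  finally show ?thesis .
qed

lemma block_diag_eq:
  "(block_diag k a :: 'n rmat) = (\<Sum>j=1..Suc p. a j *\<^sub>R (leading k j - leading k (j - 1)))"
proof -
  have "a j *\<^sub>R (leading k j - leading k (j - 1)) = mat (a j) ** (leading k j - leading k (j - 1) :: 'n rmat)" for j
    by (simp add: vec_eq_iff mat_eq_diag_mat diag_mat_matrix_mul)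
  then have "(\<Sum>j=1..Suc p. a j *\<^sub>R (leading k j - leading k (j - 1))) =
      (\<Sum>j=1..Suc p. mat (a j) ** (leading k j - leading k (j - 1) :: 'n rmat))"
    by (simp only:)
  moreover have "\<dots> = block_diag k a"
    by (simp only: vec_eq_iff sum_blocks) (simp add: block_diag_def mat_def)
  ultimately show ?thesis by simp
qed

lemma dim_colspace_leading:
  fixes A :: "'n rmat"
  assumes "invertible A" "j \<le> Suc p"
  shows "dim (colspace (A ** leading k j)) = k j"
  using assms k_le_card
  by (simp add: dim_colspace_invertible_mul leading_def dim_colspace_diag_indicator card_position_less)

lemma colspace_leading_mono:
  fixes A :: "'n rmat"
  assumes "l \<le> j" "j \<le> Suc p"
  shows "colspace (A ** leading k l) \<subseteq> colspace (A ** leading k j)"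
  using colspace_mul_subset[of "A ** leading k j" "leading k l"] leading_mul[OF assms]
  by (simp add: matrix_mul_assoc[symmetric])

lemma column_flag_in_flag_set:
  fixes A :: "'n rmat"
  assumes "invertible A"
  shows "column_flag p k A \<in> flag_set p k"
proof -
  have "column_flag p k A \<in> extensional {1..p}" by (simp add: column_flag_def)
  then show ?thesis
    using assms colspace_leading_mono
    by (auto simp: flag_set_def PiE_def column_flag_nth subspace_colspace dim_colspace_leading
      simp del: One_nat_def)
qed

lemma column_flag_eqD:
  fixes A B :: "'n rmat"
  assumes "column_flag p k A = column_flag p k B" "invertible A" "invertible B" "j \<le> Suc p"
  shows "colspace (A ** leading k j) = colspace (B ** leading k j)"
proof -
  consider "j = 0" | "j \<in> {1..p}" | "j = Suc p" using assms(4) by force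
  then show ?thesis
  proof cases
    case 1
    then show ?thesis by (simp add: leading_zero colspace_def)
  next
    case 2
    then show ?thesis using assms(1) column_flag_nth by metis
  next
    case 3
    have "colspace C = UNIV" if "invertible C" for C :: "'n rmat"
      using that matrix_inv_mul(1)[OF that]
      unfolding colspace_def by (metis matrix_vector_mul_assoc matrix_vector_mul_lid surj_def)
    then show ?thesis using 3 assms by (simp add: leading_last)
  qed
qed

lemma column_flag_eqI_subset:
  fixes A B :: "'n rmat"
  assumes "invertible A" "invertible B"
    and sub: "\<And>j. j \<in> {1..p} \<Longrightarrow> colspace (A ** leading k j) \<subseteq> colspace (B ** leading k j)"
  shows "column_flag p k A = column_flag p k B"
  by (intro column_flag_eqI subspace_dim_equal sub subspace_colspace)
    (simp_all add: dim_colspace_leading assms)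

section \<open>Unipotent parametrizations of cells\<close>

lemma strictly_block_lowerD:
  "N \<in> strictly_block_lower k \<Longrightarrow> block k r \<le> block k c \<Longrightarrow> N $ r $ c = 0"
  unfolding strictly_block_lower_def by (metis (mono_tags, lifting) leD mem_Collect_eq)

lemma leading_unipotent:
  fixes N :: "'n rmat"
  assumes N: "N \<in> strictly_block_lower k" and "j \<le> Suc p"
  shows "leading k j ** (mat 1 + N) ** leading k j = leading k j ** (mat 1 + N)"
proof -
  have "(leading k j ** (mat 1 + N) ** leading k j) $ r $ c = (leading k j ** (mat 1 + N)) $ r $ c" for r c
  proof (cases "block k c \<le> j \<or> \<not> block k r \<le> j")
    case False
    then have "N $ r $ c = 0" "r \<noteq> c" using strictly_block_lowerD[OF N, of r c] by auto
    then show ?thesis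
      using \<open>j \<le> Suc p\<close> by (simp add: leading_block matrix_mul_diag_mat diag_mat_matrix_mul mat_def)
  qed (use \<open>j \<le> Suc p\<close> in \<open>auto simp: leading_block matrix_mul_diag_mat diag_mat_matrix_mul\<close>)
  then show ?thesis by (simp add: vec_eq_iff)
qed

text \<open>
  Forward substitution: rows are treated block by block, and below the diagonal only coordinates from
  earlier blocks occur.  The truncation by \<open>leading k j\<close> covers the leading principal submatrices as well.
\<close>

lemma unipotent_kernel:
  fixes N :: "'n rmat"
  assumes N: "N \<in> strictly_block_lower k" and x: "leading k j *v ((mat 1 + N) *v x) = 0" "leading k j *v x = x"
    and j: "j \<le> Suc p"
  shows "x = 0"
proof -
  have "x $ i = 0" for i
  proof (induction "block k i" arbitrary: i rule: less_induct)
    case less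
    show ?case
    proof (cases "block k i \<le> j")
      case True
      have "0 = (leading k j *v ((mat 1 + N) *v x)) $ i" using x by simp
      also have "\<dots> = x $ i + (N *v x) $ i"
        using True j by (simp add: leading_block diag_mat_mul_vec matrix_vector_mult_add_rdistrib)
      also have "(N *v x) $ i = (\<Sum>l\<in>UNIV. N $ i $ l * x $ l)"
        by (simp add: matrix_vector_mult_def)
      also have "\<dots> = 0"
      proof (rule sum.neutral, rule ballI)
        fix l
        show "N $ i $ l * x $ l = 0"
          using N less[of l] by (cases "N $ i $ l = 0") (auto simp: strictly_block_lower_def)
      qed
      finally show ?thesis by simp
    next
      case False
      then have "(leading k j *v x) $ i = 0" using j by (simp add: leading_block diag_mat_mul_vec)
      then show ?thesis by (simp add: x(2))
    qed
  qed
  then show ?thesis by (simp add: vec_eq_iff)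
qed

lemma invertible_unipotent:
  fixes N :: "'n rmat"
  assumes "N \<in> strictly_block_lower k"
  shows "invertible (mat 1 + N)"
  by (rule invertible_kernel, rule unipotent_kernel[OF assms, of "Suc p"]) (simp_all add: leading_last)

lemma invertible_cell:
  fixes N :: "'n rmat"
  assumes "N \<in> strictly_block_lower k" "invertible g"
  shows "invertible (g ** (mat 1 + N))"
  using assms invertible_unipotent invertible_mult by blast

lemma colspace_mul_left_cancel:
  fixes g A B :: "'n rmat"
  assumes "invertible g" "colspace (g ** A) \<subseteq> colspace (g ** B)"
  shows "colspace A \<subseteq> colspace B"
proof -
  have "inj ((*v) g)" using inj_matrix_vector_mult[OF assms(1)] .
  moreover have "colspace (g ** C) = (*v) g ` colspace C" for C :: "'n rmat"
    by (auto simp: colspace_def matrix_vector_mul_assoc[symmetric])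
  ultimately show ?thesis using assms(2) by (metis inj_image_subset_iff)
qed

text \<open>
  Fix a column \<open>c\<close>, in block \<open>j\<close> say.  The \<open>c\<close>-th columns of \<open>1 + N\<close> and \<open>1 + N'\<close> agree in the first \<open>k\<^sub>j\<close>
  coordinates, and their difference lies in the common span of the first \<open>k\<^sub>j\<close> columns; by
  \<open>unipotent_kernel\<close> only \<open>0\<close> in that span has vanishing first \<open>k\<^sub>j\<close> coordinates.
\<close>

lemma cell_param_inj:
  fixes g :: "'n rmat"
  assumes g: "invertible g"
  shows "inj_on (cell_param p k g) (strictly_block_lower k)"
proof (rule inj_onI)
  fix N N' :: "'n rmat"
  assume N: "N \<in> strictly_block_lower k" and N': "N' \<in> strictly_block_lower k"
    and eq: "cell_param p k g N = cell_param p k g N'"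
  let ?A = "mat 1 + N" and ?A' = "mat 1 + N'"
  have "column c ?A = column c ?A'" for c
  proof -
    let ?j = "block k c" and ?e = "axis c (1::real)"
    let ?E = "leading k ?j :: 'n rmat"
    have j: "?j \<le> Suc p" using block_range[of c] by simp
    have Ee: "?E *v ?e = ?e"
      using j by (simp add: vec_eq_iff leading_block diag_mat_mul_vec axis_def)
    have lead: "?E *v ((mat 1 + M) *v ?e) = ?e" if "M \<in> strictly_block_lower k" for M
    proof -
      have "(?E *v ((mat 1 + M) *v ?e)) $ r = ?e $ r" for r
        using that j unfolding matrix_vector_mult_basis
        by (auto simp: leading_block diag_mat_mul_vec column_def mat_def axis_def strictly_block_lowerD)
      then show ?thesis by (simp add: vec_eq_iff)
    qed
    have "colspace (g ** (?A ** ?E)) = colspace (g ** (?A' ** ?E))"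
      using column_flag_eqD[OF eq[unfolded cell_param_def] invertible_cell[OF N g] invertible_cell[OF N' g] j]
      by (simp add: matrix_mul_assoc)
    then have "colspace (?A' ** ?E) \<subseteq> colspace (?A ** ?E)"
      using colspace_mul_left_cancel[OF g] by blast
    moreover have "?A' *v ?e \<in> colspace (?A' ** ?E)" "?A *v ?e \<in> colspace (?A ** ?E)"
      unfolding colspace_def by (metis Ee matrix_vector_mul_assoc rangeI)+
    ultimately have "?A' *v ?e - ?A *v ?e \<in> colspace (?A ** ?E)"
      using subspace_diff[OF subspace_colspace] by blast
    then obtain y where y: "?A' *v ?e - ?A *v ?e = ?A *v (?E *v y)"
      by (auto simp: colspace_def matrix_vector_mul_assoc)
    have "?E *v y = 0"
    proof (rule unipotent_kernel[OF N _ _ j])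
      show "?E *v (?A *v (?E *v y)) = 0"
        unfolding y[symmetric] by (simp add: matrix_vector_mult_diff_distrib lead[OF N] lead[OF N'])
      show "?E *v (?E *v y) = ?E *v y" by (simp add: matrix_vector_mul_assoc leading_idem)
    qed
    then have "?A' *v ?e = ?A *v ?e" using y by simp
    then show ?thesis by (simp add: matrix_vector_mult_basis)
  qed
  then have "?A = ?A'" by (simp add: column_def vec_eq_iff)
  then show "N = N'" by simp
qed

lemma subspace_strictly_block_lower: "subspace (strictly_block_lower k :: 'n rmat set)"
  by (auto simp: subspace_def strictly_block_lower_def) (metis add.right_neutral)

end

section \<open>Rotations with columns in prescribed orthogonal subspaces\<close>

text \<open>
  Orthonormal bases of the subspaces, distributed over the index fibres of \<open>b\<close>, form an orthogonal
  matrix.  If its determinant is \<open>-1\<close>, reversing one column makes it a rotation without moving that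
  column out of its subspace.
\<close>

lemma rotation_with_columns_in:
  fixes V :: "nat \<Rightarrow> (real^'n) set" and b :: "'n \<Rightarrow> nat"
  assumes sub: "\<And>j. j \<in> range b \<Longrightarrow> subspace (V j)"
    and orth: "\<And>j l x y. j \<in> range b \<Longrightarrow> l \<in> range b \<Longrightarrow> j \<noteq> l \<Longrightarrow> x \<in> V j \<Longrightarrow> y \<in> V l \<Longrightarrow> orthogonal x y"
    and dim: "\<And>j. j \<in> range b \<Longrightarrow> dim (V j) = card {i. b i = j}"
  shows "\<exists>Q :: real^'n^'n. rotation_matrix Q \<and> (\<forall>i. column i Q \<in> V (b i))"
proof -
  have "\<exists>h. \<forall>i. b i = j \<longrightarrow> h i \<in> V j \<and> norm (h i) = 1 \<and> (\<forall>l. b l = j \<longrightarrow> i \<noteq> l \<longrightarrow> orthogonal (h i) (h l))"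
    if j: "j \<in> range b" for j
  proof -
    obtain B where B: "B \<subseteq> V j" "pairwise orthogonal B" "\<And>x. x \<in> B \<Longrightarrow> norm x = 1"
        "independent B" "card B = dim (V j)"
      using orthonormal_basis_subspace[OF sub[OF j]] by metis
    have "card {i. b i = j} = card B" using B(5) dim[OF j] by simp
    then obtain h where h: "bij_betw h {i. b i = j} B"
      using finite_same_card_bij[of "{i. b i = j}" B] independent_imp_finite[OF B(4)] by auto
    have "h i \<in> B" if "b i = j" for i using bij_betw_apply[OF h] that by simp
    moreover have "h i \<noteq> h l" if "b i = j" "b l = j" "i \<noteq> l" for i l
      using bij_betw_imp_inj_on[OF h] that by (auto dest: inj_onD)
    ultimately show ?thesis
      using B(1-3) by (intro exI[of _ h]) (auto simp: pairwise_def)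
  qed
  then obtain h where h: "\<And>i. h (b i) i \<in> V (b i)" "\<And>i. norm (h (b i) i) = 1"
      "\<And>i l. b l = b i \<Longrightarrow> i \<noteq> l \<Longrightarrow> orthogonal (h (b i) i) (h (b i) l)"
    by (metis rangeI)
  define Q :: "real^'n^'n" where "Q = (\<chi> r i. h (b i) i $ r)"
  have col: "column i Q = h (b i) i" for i by (simp add: Q_def column_def vec_eq_iff)
  have "orthogonal (h (b i) i) (h (b l) l)" if "i \<noteq> l" for i l
    using h(3)[of l i] orth[of "b i" "b l"] h(1) that by (cases "b l = b i") auto
  then have Q: "orthogonal_matrix Q"
    by (simp add: orthogonal_matrix_orthonormal_columns col h(2))
  show ?thesis
  proof (cases "det Q = 1")
    case True
    then show ?thesis using Q h(1) by (auto simp: rotation_matrix_def col)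
  next
    case False
    then have det: "det Q = -1" using det_orthogonal_matrix[OF Q] by auto
    obtain i0 :: 'n where True by blast
    let ?d = "\<lambda>i. if i = i0 then -1 else (1::real)"
    have "orthogonal_matrix (diag_mat ?d)"
      by (simp add: orthogonal_matrix transpose_diag_mat diag_mat_mul mat_eq_diag_mat) (rule arg_cong[of _ _ diag_mat], auto)
    moreover have "det (diag_mat ?d) = -1"
      by (subst det_diagonal) (simp_all add: diag_mat_def)
    ultimately have "rotation_matrix (Q ** diag_mat ?d)"
      using Q det by (simp add: rotation_matrix_def orthogonal_matrix_mul det_mul)
    moreover have "column i (Q ** diag_mat ?d) \<in> V (b i)" for i
    proof -
      have "column i (Q ** diag_mat ?d) = ?d i *\<^sub>R column i Q"
        by (simp add: column_def matrix_mul_diag_mat vec_eq_iff)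
      then show ?thesis using subspace_scale[OF sub h(1)] by (simp add: col)
    qed
    ultimately show ?thesis by blast
  qed
qed

lemma sum_dim_orthogonal_subspaces:
  fixes V :: "'j \<Rightarrow> 'e::euclidean_space set"
  assumes "finite J" and sub: "\<And>j. j \<in> J \<Longrightarrow> subspace (V j)"
    and orth: "\<And>j l x y. j \<in> J \<Longrightarrow> l \<in> J \<Longrightarrow> j \<noteq> l \<Longrightarrow> x \<in> V j \<Longrightarrow> y \<in> V l \<Longrightarrow> orthogonal x y"
    and full: "span (\<Union>j\<in>J. V j) = UNIV"
  shows "(\<Sum>j\<in>J. dim (V j)) = DIM('e)"
proof -
  have "\<exists>B. B \<subseteq> V j \<and> pairwise orthogonal B \<and> 0 \<notin> B \<and> finite B \<and> card B = dim (V j) \<and> span B = V j"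
    if j: "j \<in> J" for j
  proof -
    obtain B where "B \<subseteq> V j" "pairwise orthogonal B" "\<And>x. x \<in> B \<Longrightarrow> norm x = 1"
        "independent B" "card B = dim (V j)" "span B = V j"
      using orthonormal_basis_subspace[OF sub[OF j]] by metis
    then show ?thesis using dependent_zero independent_imp_finite by blast
  qed
  then have "\<exists>B. \<forall>j\<in>J. B j \<subseteq> V j \<and> pairwise orthogonal (B j) \<and> 0 \<notin> B j \<and> finite (B j) \<and>
      card (B j) = dim (V j) \<and> span (B j) = V j"
    by (intro bchoice ballI)
  then obtain B where "\<forall>j\<in>J. B j \<subseteq> V j \<and> pairwise orthogonal (B j) \<and> 0 \<notin> B j \<and> finite (B j) \<and>
      card (B j) = dim (V j) \<and> span (B j) = V j" ..
  then have B: "\<And>j. j \<in> J \<Longrightarrow> B j \<subseteq> V j" "\<And>j. j \<in> J \<Longrightarrow> pairwise orthogonal (B j)"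
      "\<And>j. j \<in> J \<Longrightarrow> 0 \<notin> B j" "\<And>j. j \<in> J \<Longrightarrow> finite (B j)" "\<And>j. j \<in> J \<Longrightarrow> card (B j) = dim (V j)"
      "\<And>j. j \<in> J \<Longrightarrow> span (B j) = V j"
    by simp_all
  let ?B = "\<Union>j\<in>J. B j"
  have orthB: "orthogonal x y" if "j \<in> J" "l \<in> J" "x \<in> B j" "y \<in> B l" "x \<noteq> y" for j l x y
    using that B(1,2) orth by (cases "j = l") (auto simp: pairwise_def, blast)
  have "independent ?B"
    using orthB B(3) by (intro pairwise_orthogonal_independent) (auto simp: pairwise_def)
  moreover have "span ?B = UNIV"
  proof -
    have "V j \<subseteq> span ?B" if "j \<in> J" for j
      using B(6)[OF that] span_mono[of "B j" ?B] that by auto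
    then have "span (\<Union>j\<in>J. V j) \<subseteq> span ?B" by (intro span_minimal) auto
    then show ?thesis using full by auto
  qed
  ultimately have "card ?B = DIM('e)"
    by (metis dim_UNIV dim_eq_card_independent dim_span)
  moreover have "card ?B = (\<Sum>j\<in>J. card (B j))"
  proof (rule card_UN_disjoint)
    show "\<forall>i\<in>J. \<forall>j\<in>J. i \<noteq> j \<longrightarrow> B i \<inter> B j = {}"
    proof (intro ballI impI equals0I)
      fix i j x assume *: "i \<in> J" "j \<in> J" "i \<noteq> j" "x \<in> B i \<inter> B j"
      then have "orthogonal x x" using B(1) orth by blast
      then show False using * B(3) by (auto simp: orthogonal_self)
    qed
  qed (use assms(1) B(4) in auto)
  ultimately show ?thesis using B(5) by simp
qed

lemma exists_fun_with_fibre_cards: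
  fixes d :: "'j \<Rightarrow> nat"
  assumes "finite J" "(\<Sum>j\<in>J. d j) = CARD('n::finite)"
  shows "\<exists>b :: 'n \<Rightarrow> 'j. range b \<subseteq> J \<and> (\<forall>j\<in>J. card {i. b i = j} = d j)"
proof -
  let ?S = "SIGMA j:J. {..<d j}"
  have "card ?S = CARD('n)" using assms by simp
  then obtain h where h: "bij_betw h (UNIV :: 'n set) ?S"
    using finite_same_card_bij[of "UNIV :: 'n set" ?S] assms(1) by auto
  have "card {i. fst (h i) = j} = d j" if "j \<in> J" for j
  proof -
    have "bij_betw h {i. fst (h i) = j} ({j} \<times> {..<d j})"
      unfolding bij_betw_def
    proof
      show "inj_on h {i. fst (h i) = j}" using bij_betw_imp_inj_on[OF h] inj_on_subset by blast
      have "x \<in> h ` {i. fst (h i) = j}" if "x \<in> {j} \<times> {..<d j}" for x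
      proof -
        have "x \<in> ?S" using that \<open>j \<in> J\<close> by auto
        then obtain i where "x = h i" using bij_betw_imp_surj_on[OF h] by blast
        then show ?thesis using that by auto
      qed
      moreover have "h i \<in> {j} \<times> {..<d j}" if "fst (h i) = j" for i
        using bij_betw_apply[OF h, of i] that by auto
      ultimately show "h ` {i. fst (h i) = j} = {j} \<times> {..<d j}" by blast
    qed
    then show ?thesis using bij_betw_same_card by fastforce
  qed
  moreover have "range (fst \<circ> h) \<subseteq> J" using bij_betw_apply[OF h] by fastforce
  ultimately show ?thesis by (intro exI[of _ "fst \<circ> h"]) auto
qed

section \<open>Polynomials in a symmetric matrix\<close>

lemma exists_interpolation:
  fixes a :: "nat \<Rightarrow> real"
  assumes "inj_on a {1..Suc p}"
  shows "\<exists>q :: real poly. degree q \<le> p \<and> (\<forall>l\<in>{1..Suc p}. poly q (a l) = v l)"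
proof -
  let ?J = "{1..Suc p}"
  let ?L = "\<lambda>l. \<Prod>i\<in>?J - {l}. [:- a i, 1:]"
  let ?q = "\<Sum>l\<in>?J. smult (v l / poly (?L l) (a l)) (?L l)"
  have deg: "degree (?L l) \<le> p" if "l \<in> ?J" for l
  proof -
    have "degree (?L l) \<le> (\<Sum>i\<in>?J - {l}. degree [:- a i, 1:])"
      using degree_prod_sum_le[of "?J - {l}" "\<lambda>i. [:- a i, 1:]"] by (simp add: comp_def)
    also have "\<dots> = p" using that by simp
    finally show ?thesis .
  qed
  have "degree ?q \<le> p"
    by (rule degree_sum_le, simp) (rule order_trans[OF degree_smult_le deg])
  moreover have "poly ?q (a m) = v m" if m: "m \<in> ?J" for m
  proof -
    have 0: "poly (?L l) (a m) = 0" if "l \<noteq> m" for l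
      using that m by (auto simp: poly_prod)
    have nz: "poly (?L m) (a m) \<noteq> 0"
      using assms m by (auto simp: poly_prod dest: inj_onD)
    have "poly ?q (a m) = (\<Sum>l\<in>?J. if l = m then v m else 0)"
      unfolding poly_sum poly_smult
    proof (rule sum.cong[OF refl])
      fix l show "v l / poly (?L l) (a l) * poly (?L l) (a m) = (if l = m then v m else 0)"
        using 0[of l] nz by (cases "l = m") auto
    qed
    then show ?thesis using m by simp
  qed
  ultimately show ?thesis by blast
qed

text \<open>
  The evaluation \<open>q(X)\<close>; it is written out because multiplication in the type of matrices is
  componentwise.
\<close>

definition matrix_poly :: "real poly \<Rightarrow> real^'n^'n \<Rightarrow> real^'n^'n" where
  "matrix_poly q X = (\<Sum>i\<le>degree q. coeff q i *\<^sub>R matrix_power X i)"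

lemma matrix_power_Suc: "matrix_power X (Suc m) = X ** matrix_power X m"
  by (simp add: matrix_power_def)

lemma hdiff_on_matrix_power: "open W \<Longrightarrow> higher_differentiable_on W (\<lambda>X. matrix_power X i) m"
  by (induction i)
    (simp_all add: matrix_power_Suc hdiff_on_matrix_mul hdiff_on_id, simp add: matrix_power_def hdiff_on_const)

lemma hdiff_on_matrix_poly: "open W \<Longrightarrow> higher_differentiable_on W (matrix_poly q) m"
  unfolding matrix_poly_def[abs_def] by (intro hdiff_on_sum hdiff_on_scaleR hdiff_on_matrix_power)

lemma conj_diag_mul:
  fixes Q :: "real^'n^'n"
  assumes "orthogonal_matrix Q"
  shows "(Q ** diag_mat d ** transpose Q) ** (Q ** diag_mat e ** transpose Q) = Q ** diag_mat (\<lambda>i. d i * e i) ** transpose Q"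
proof -
  have "(Q ** diag_mat d ** transpose Q) ** (Q ** diag_mat e ** transpose Q)
      = Q ** diag_mat d ** (transpose Q ** Q) ** diag_mat e ** transpose Q"
    by (simp add: matrix_mul_assoc)
  also have "\<dots> = Q ** (diag_mat d ** diag_mat e) ** transpose Q"
    using assms by (simp add: orthogonal_matrix matrix_mul_assoc)
  finally show ?thesis by (simp add: diag_mat_mul)
qed

lemma conj_diag_const:
  fixes Q :: "real^'n^'n"
  assumes "orthogonal_matrix Q"
  shows "Q ** diag_mat (\<lambda>_. c) ** transpose Q = mat c"
proof -
  have "diag_mat (\<lambda>_. c) = c *\<^sub>R (mat 1 :: real^'n^'n)"
    by (simp add: mat_eq_diag_mat diag_mat_scaleR)
  then have "Q ** diag_mat (\<lambda>_. c) ** transpose Q = c *\<^sub>R (Q ** transpose Q)"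
    by (simp add: bounded_bilinear.scaleR_left[OF bounded_bilinear_matrix_mul]
        bounded_bilinear.scaleR_right[OF bounded_bilinear_matrix_mul])
  then show ?thesis using assms by (simp add: orthogonal_matrix_def mat_eq_diag_mat diag_mat_scaleR)
qed

lemma matrix_power_conj:
  fixes Q :: "real^'n^'n"
  assumes "orthogonal_matrix Q"
  shows "matrix_power (Q ** diag_mat d ** transpose Q) m = Q ** diag_mat (\<lambda>i. d i ^ m) ** transpose Q"
proof (induction m)
  case 0
  then show ?case using conj_diag_const[OF assms, of 1] by (simp add: matrix_power_def)
next
  case (Suc m)
  then show ?case by (simp add: matrix_power_Suc conj_diag_mul[OF assms])
qed

lemma matrix_poly_conj:
  fixes Q :: "real^'n^'n"
  assumes "orthogonal_matrix Q"
  shows "matrix_poly q (Q ** diag_mat d ** transpose Q) = Q ** diag_mat (\<lambda>i. poly q (d i)) ** transpose Q"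
proof -
  have "matrix_poly q (Q ** diag_mat d ** transpose Q)
      = Q ** (\<Sum>i\<le>degree q. coeff q i *\<^sub>R diag_mat (\<lambda>l. d l ^ i)) ** transpose Q"
    by (simp add: matrix_poly_def matrix_power_conj[OF assms] matrix_sum_ldistrib matrix_sum_rdistrib
        bounded_bilinear.scaleR_left[OF bounded_bilinear_matrix_mul]
        bounded_bilinear.scaleR_right[OF bounded_bilinear_matrix_mul])
  then show ?thesis by (simp add: diag_mat_scaleR diag_mat_sum poly_altdef)
qed

lemma trace_conj:
  fixes Q :: "real^'n^'n"
  assumes "orthogonal_matrix Q"
  shows "trace (Q ** A ** transpose Q) = trace A"
  using assms by (metis matrix_mul_assoc matrix_mul_rid orthogonal_matrix trace_mul_sym)

lemma diagonalized_by_eigenvectors: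
  fixes Q X :: "real^'n^'n"
  assumes "orthogonal_matrix Q" "\<And>i. X *v column i Q = d i *\<^sub>R column i Q"
  shows "X = Q ** diag_mat d ** transpose Q"
proof -
  have "(X ** Q) *v axis i 1 = (Q ** diag_mat d) *v axis i 1" for i
    using assms(2)[of i]
    by (simp add: matrix_vector_mul_assoc[symmetric] matrix_vector_mult_basis)
      (simp add: matrix_vector_mult_basis[symmetric] matrix_vector_mul_assoc,
       simp add: matrix_vector_mult_basis column_def matrix_mul_diag_mat vec_eq_iff)
  then have "X ** Q = Q ** diag_mat d"
    by (simp add: matrix_vector_mult_basis column_def vec_eq_iff)
  then show ?thesis
    using assms(1) by (metis matrix_mul_assoc matrix_mul_rid orthogonal_matrix_def)
qed

section \<open>Orthonormal bases adapted to a flag\<close>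

context flag_dims
begin

text \<open>
  The orthogonal complements of each member of the flag in the next one are pairwise orthogonal, and their
  dimensions are the block sizes.  Columns chosen from them span the flag.
\<close>

lemma flag_has_rotation:
  assumes F: "F \<in> flag_set p k"
  shows "\<exists>Q :: 'n rmat. rotation_matrix Q \<and> column_flag p k Q = F"
proof -
  \<comment> \<open>the flag is completed by \<open>0\<close> and the whole space, so that every block arises in the same way\<close>
  define W where "W j = (if j = 0 then {0} else if j \<le> p then F j else (UNIV :: 'n rvec set))" for j
  define V where "V j = {y \<in> W j. \<forall>x\<in>W (j - 1). orthogonal x y}" for j
  have FE: "F \<in> (\<Pi>\<^sub>E j\<in>{1..p}. {W. subspace W \<and> dim W = k j})" "\<forall>j\<in>{1..<p}. F j \<subseteq> F (Suc j)"
    using F by (auto simp: flag_set_def)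
  have Fj: "subspace (F j)" "dim (F j) = k j" if "j \<in> {1..p}" for j
    using PiE_mem[OF FE(1) that] by auto
  have sub: "subspace (W j)" for j
    using Fj(1)[of j] by (auto simp: W_def subspace_0 Suc_le_eq)
  have dimW: "dim (W j) = k j" if "j \<le> Suc p" for j
    using Fj(2)[of j] that k_zero k_last by (auto simp: W_def Suc_le_eq le_Suc_eq)
  have step: "W j \<subseteq> W (Suc j)" for j
    using subspace_0[OF sub[of "Suc j"]] FE(2) by (auto simp: W_def)
  have mono: "W i \<subseteq> W j" if "i \<le> j" for i j
    using that by (induction rule: dec_induct) (use step in auto)
  have subV: "subspace (V j)" for j
    using sub[of j] by (auto simp: V_def subspace_def orthogonal_clauses)
  have dimV: "dim (V j) = card {i :: 'n. block k i = j}" if "j \<in> {1..Suc p}" for j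
  proof -
    have "dim (V j) + dim (W (j - 1)) = dim (W j)"
      unfolding V_def by (rule dim_subspace_orthogonal_to_vectors[OF sub sub mono]) simp
    moreover have "j \<le> Suc p" "j - 1 \<le> Suc p" using that by auto
    ultimately show ?thesis by (simp only: dimW card_block[OF that])
  qed
  have orth1: "orthogonal x y" if "j < l" "x \<in> V j" "y \<in> V l" for j l x y
  proof -
    have "j \<le> l - 1" using that(1) by simp
    then show ?thesis using that mono[of j "l - 1"] by (auto simp: V_def)
  qed
  then have orth: "orthogonal x y" if "j \<noteq> l" "x \<in> V j" "y \<in> V l" for j l x y
    using that by (metis linorder_neqE_nat orthogonal_commute)
  have "\<exists>Q :: 'n rmat. rotation_matrix Q \<and> (\<forall>i. column i Q \<in> V (block k i))"
    by (rule rotation_with_columns_in[OF subV orth dimV]) (use block_range in auto)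
  then obtain Q :: "'n rmat" where Q: "rotation_matrix Q" "\<And>i. column i Q \<in> V (block k i)" by blast
  have invQ: "invertible Q" using Q(1) by (simp add: rotation_matrix_def invertible_det_nz)
  have "column_flag p k Q j = F j" if j: "j \<in> {1..p}" for j
  proof -
    have "span {column i Q |i. position i < k j} \<subseteq> F j"
    proof (rule span_minimal[OF _ Fj(1)[OF j]], clarify)
      fix i :: 'n assume "position i < k j"
      then have "block k i \<le> j" using block_le_iff[of j i] j by simp
      then have "column i Q \<in> W j" using Q(2)[of i] mono[of "block k i" j] by (auto simp: V_def)
      then show "column i Q \<in> F j" using j by (auto simp: W_def)
    qed
    then have "colspace (Q ** leading k j) \<subseteq> F j"
      by (simp add: leading_def span_leading_columns)
    then have "colspace (Q ** leading k j) = F j"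
      using j by (intro subspace_dim_equal subspace_colspace Fj(1)) (simp_all add: dim_colspace_leading[OF invQ] Fj(2))
    then show ?thesis by (simp add: column_flag_nth[OF j])
  qed
  moreover have "column_flag p k Q j = F j" if "j \<notin> {1..p}" for j
    using that PiE_arb[OF FE(1)] by (auto simp: column_flag_def)
  ultimately show ?thesis using Q(1) by blast
qed

end

section \<open>The isospectral set as an orbit of the rotation group\<close>

locale isospectral_dims = flag_dims p k index_type
  for p :: nat and k :: "nat \<Rightarrow> nat" and index_type :: "'n::{finite,linorder} itself" +
  fixes a :: "nat \<Rightarrow> real"
  assumes inj_a: "inj_on a {1..Suc p}"
begin

abbreviation spectral_matrix :: "'n rmat \<Rightarrow> 'n rmat" where
  "spectral_matrix Q \<equiv> Q ** block_diag k a ** transpose Q"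

abbreviation isospectral :: "'n rmat set" where
  "isospectral \<equiv> isospectral_flags p k a"

lemma block_diag_diag_mat: "(block_diag k a :: 'n rmat) = diag_mat (\<lambda>i. a (block k i))"
  by (simp add: block_diag_def diag_mat_def)

lemma sum_over_blocks:
  fixes b :: "'n \<Rightarrow> nat"
  assumes "\<And>i. b i \<in> {1..Suc p}"
  shows "(\<Sum>i\<in>UNIV. f (b i)) = (\<Sum>j=1..Suc p. real (card {i. b i = j}) * (f j :: real))"
proof -
  have "(\<Sum>i\<in>UNIV. f (b i)) = (\<Sum>j=1..Suc p. \<Sum>i\<in>{i \<in> UNIV. b i = j}. f (b i))"
    by (rule sum.group[symmetric]) (use assms in auto)
  also have "\<dots> = (\<Sum>j=1..Suc p. real (card {i. b i = j}) * f j)"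
    by (intro sum.cong refl) simp
  finally show ?thesis .
qed

lemma sum_block_dims:
  "(\<Sum>j=0..p. real (k (Suc j) - k j) * f (Suc j)) = (\<Sum>j=1..Suc p. real (card {i :: 'n. block k i = j}) * f j)"
proof -
  have "(\<Sum>j=1..Suc p. real (card {i :: 'n. block k i = j}) * f j)
      = (\<Sum>j=0..p. real (card {i :: 'n. block k i = Suc j}) * f (Suc j))"
    by (simp only: One_nat_def sum.shift_bounds_cl_Suc_ivl)
  also have "\<dots> = (\<Sum>j=0..p. real (k (Suc j) - k j) * f (Suc j))"
    by (intro sum.cong refl) (simp add: card_block)
  finally show ?thesis by simp
qed

lemma spectral_matrix_in_isospectral:
  assumes Q: "orthogonal_matrix Q"
  shows "spectral_matrix Q \<in> isospectral"
proof -
  let ?X = "spectral_matrix Q"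
  have X: "?X = Q ** diag_mat (\<lambda>i. a (block k i)) ** transpose Q" by (simp add: block_diag_diag_mat)
  have "transpose ?X = ?X"
    by (simp add: X matrix_transpose_mul transpose_diag_mat matrix_mul_assoc)
  moreover have "foldr (\<lambda>j B. (?X - mat (a (Suc j))) ** B) js (mat 1)
      = Q ** diag_mat (\<lambda>i. \<Prod>j\<leftarrow>js. a (block k i) - a (Suc j)) ** transpose Q" for js
  proof (induction js)
    case Nil
    then show ?case by (simp add: conj_diag_const[OF Q])
  next
    case (Cons j js)
    have "?X - mat (a (Suc j)) = Q ** diag_mat (\<lambda>i. a (block k i) - a (Suc j)) ** transpose Q"
      unfolding X conj_diag_const[OF Q, symmetric]
      by (simp add: matrix_diff_ldistrib[symmetric] matrix_diff_rdistrib[symmetric] diag_mat_diff)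
    then show ?case using Cons by (simp add: conj_diag_mul[OF Q])
  qed
  moreover have "(\<Prod>j\<leftarrow>[0..<Suc p]. a (block k i) - a (Suc j)) = 0" for i :: 'n
  proof -
    have "block k i - 1 \<in> set [0..<Suc p]" "Suc (block k i - 1) = block k i"
      using block_range[of i] by auto
    then show ?thesis by (force simp: prod_list_zero_iff simp del: upt_Suc)
  qed
  moreover have "trace (matrix_power ?X m) = (\<Sum>j=0..p. real (k (Suc j) - k j) * a (Suc j) ^ m)" for m
    unfolding sum_block_dims[of "\<lambda>j. a j ^ m"] X
    by (simp only: matrix_power_conj[OF Q] trace_conj[OF Q] trace_diag_mat sum_over_blocks[OF block_range, of "\<lambda>j. a j ^ m"])
  ultimately show ?thesis
    by (simp add: isospectral_flags_def conj_diag_const[OF Q] mat_eq_diag_mat[symmetric] del: upt_Suc)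
qed

text \<open>
  Peel off the last factor: if \<open>(X - a\<^sub>m\<^sub>+\<^sub>1) v = \<Sum> w\<^sub>j\<close> with eigenvectors \<open>w\<^sub>j\<close> for the other eigenvalues, then
  \<open>v - \<Sum> w\<^sub>j / (a\<^sub>j - a\<^sub>m\<^sub>+\<^sub>1)\<close> is an eigenvector for \<open>a\<^sub>m\<^sub>+\<^sub>1\<close>.
\<close>

lemma annihilated_in_span_eigenspaces:
  fixes X :: "'n rmat"
  assumes "foldr (\<lambda>j B. (X - mat (a (Suc j))) ** B) [0..<m] (mat 1) *v v = 0" "m \<le> Suc p"
  shows "\<exists>w. (\<forall>j\<in>{1..m}. X *v w j = a j *\<^sub>R w j) \<and> v = (\<Sum>j=1..m. w j)"
  using assms
proof (induction m arbitrary: v)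
  case 0
  then show ?case by simp
next
  case (Suc m)
  let ?P = "\<lambda>m B. foldr (\<lambda>j B. (X - mat (a (Suc j))) ** B) [0..<m] B"
  have "foldr (\<lambda>j B. (X - mat (a (Suc j))) ** B) js B
      = foldr (\<lambda>j B. (X - mat (a (Suc j))) ** B) js (mat 1) ** B" for js and B :: "'n rmat"
    by (induction js) (simp_all add: matrix_mul_assoc)
  then have comm: "?P m B = ?P m (mat 1) ** B" for B :: "'n rmat" .
  have mv: "mat c *v x = c *\<^sub>R x" for c and x :: "'n rvec"
    by (simp add: vec_eq_iff mat_eq_diag_mat diag_mat_mul_vec)
  let ?u = "X *v v - a (Suc m) *\<^sub>R v"
  have "?P m (mat 1) *v ?u = ?P (Suc m) (mat 1) *v v"
    by (simp add: comm[of "X - mat (a (Suc m))"] matrix_vector_mul_assoc[symmetric]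
        matrix_vector_mult_diff_rdistrib mv)
  then obtain w where w: "\<forall>j\<in>{1..m}. X *v w j = a j *\<^sub>R w j" "?u = (\<Sum>j=1..m. w j)"
    using Suc.IH[of ?u] Suc.prems by auto
  have ne: "a j - a (Suc m) \<noteq> 0" if "j \<in> {1..m}" for j
    using inj_onD[OF inj_a, of j "Suc m"] that Suc.prems(2) by auto
  let ?w = "\<lambda>j. (1 / (a j - a (Suc m))) *\<^sub>R w j"
  let ?r = "v - (\<Sum>j=1..m. ?w j)"
  have "X *v (\<Sum>j=1..m. ?w j) - a (Suc m) *\<^sub>R (\<Sum>j=1..m. ?w j) = (\<Sum>j=1..m. w j)"
  proof -
    have "X *v (\<Sum>j=1..m. ?w j) - a (Suc m) *\<^sub>R (\<Sum>j=1..m. ?w j)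
        = (\<Sum>j=1..m. X *v ?w j - a (Suc m) *\<^sub>R ?w j)"
      by (simp add: linear_sum[OF matrix_vector_mul_linear] scaleR_sum_right sum_subtractf)
    also have "\<dots> = (\<Sum>j=1..m. w j)"
    proof (rule sum.cong[OF refl])
      fix j assume j: "j \<in> {1..m}"
      have "X *v ?w j - a (Suc m) *\<^sub>R ?w j = (1 / (a j - a (Suc m))) *\<^sub>R (X *v w j - a (Suc m) *\<^sub>R w j)"
        by (simp add: matrix_vector_mult_scaleR scaleR_diff_right)
      also have "X *v w j - a (Suc m) *\<^sub>R w j = (a j - a (Suc m)) *\<^sub>R w j"
        using w(1) j by (simp add: scaleR_diff_left)
      finally show "X *v ?w j - a (Suc m) *\<^sub>R ?w j = w j" using ne[OF j] by simp
    qed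
    finally show ?thesis .
  qed
  then have "X *v ?r = a (Suc m) *\<^sub>R ?r"
    using w(2) by (simp add: matrix_vector_mult_diff_distrib algebra_simps)
  then have "\<forall>j\<in>{1..Suc m}. X *v (if j \<le> m then ?w j else ?r) = a j *\<^sub>R (if j \<le> m then ?w j else ?r)"
    using w(1) by (auto simp: matrix_vector_mult_scaleR le_Suc_eq)
  moreover have "v = (\<Sum>j=1..Suc m. if j \<le> m then ?w j else ?r)" by simp
  ultimately show ?case by (intro exI[of _ "\<lambda>j. if j \<le> m then ?w j else ?r"] conjI)
qed

text \<open>
  The polynomial equation makes \<open>\<real>\<^sup>n\<close> the orthogonal sum of the eigenspaces of \<open>X\<close>.  The traces of
  \<open>X\<^sup>0, \<dots>, X\<^sup>p\<close> determine the dimensions of these: with weights equal to the dimensions, the sums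
  \<open>\<Sum>\<^sub>l w\<^sub>l q(a\<^sub>l)\<close> are known for all polynomials \<open>q\<close> of degree at most \<open>p\<close>, and the interpolation polynomial
  of a single \<open>a\<^sub>j\<close> isolates one weight.
\<close>

lemma isospectral_has_rotation:
  assumes "X \<in> isospectral"
  shows "\<exists>Q. rotation_matrix Q \<and> X = spectral_matrix Q"
proof -
  have sym: "transpose X = X"
    and ann: "foldr (\<lambda>j B. (X - mat (a (Suc j))) ** B) [0..<Suc p] (mat 1) = 0"
    and tr: "\<And>i. i \<in> {1..p} \<Longrightarrow> trace (matrix_power X i) = (\<Sum>j=0..p. real (k (Suc j) - k j) * a (Suc j) ^ i)"
    using assms by (auto simp: isospectral_flags_def simp del: upt_Suc)
  define V where "V j = {x. X *v x = a j *\<^sub>R x}" for j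
  have subV: "subspace (V j)" for j
    by (auto simp: V_def subspace_def matrix_vector_right_distrib matrix_vector_mult_scaleR algebra_simps)
  have orth: "orthogonal x y" if "j \<in> {1..Suc p}" "l \<in> {1..Suc p}" "j \<noteq> l" "x \<in> V j" "y \<in> V l" for j l x y
  proof -
    have "a j * (x \<bullet> y) = (X *v x) \<bullet> y" using that(4) by (simp add: V_def)
    also have "\<dots> = x \<bullet> (X *v y)" by (simp only: inner_matrix_vector sym)
    also have "\<dots> = a l * (x \<bullet> y)" using that(5) by (simp add: V_def)
    finally show ?thesis
      using inj_onD[OF inj_a, of j l] that(1-3) by (auto simp: orthogonal_def)
  qed
  have "span (\<Union>j\<in>{1..Suc p}. V j) = UNIV"
  proof -
    have "v \<in> span (\<Union>j\<in>{1..Suc p}. V j)" for v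
    proof -
      obtain w where w: "\<forall>j\<in>{1..Suc p}. X *v w j = a j *\<^sub>R w j" "v = (\<Sum>j=1..Suc p. w j)"
        using annihilated_in_span_eigenspaces[of X "Suc p" v] ann by auto
      show ?thesis unfolding w(2) using w(1) by (intro span_sum span_base) (auto simp: V_def)
    qed
    then show ?thesis by auto
  qed
  then have "(\<Sum>j\<in>{1..Suc p}. dim (V j)) = CARD('n)"
    using sum_dim_orthogonal_subspaces[of "{1..Suc p}" V] subV orth by simp
  then obtain b :: "'n \<Rightarrow> nat" where b: "range b \<subseteq> {1..Suc p}" "\<forall>j\<in>{1..Suc p}. card {i. b i = j} = dim (V j)"
    using exists_fun_with_fibre_cards[of "{1..Suc p}" "\<lambda>j. dim (V j)"] by auto
  have br: "b i \<in> {1..Suc p}" for i using subsetD[OF b(1) rangeI] .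
  have "\<exists>Q :: 'n rmat. rotation_matrix Q \<and> (\<forall>i. column i Q \<in> V (b i))"
    by (rule rotation_with_columns_in[OF subV orth]) (use b in auto)
  then obtain Q where Q: "orthogonal_matrix Q" "\<And>i. column i Q \<in> V (b i)"
    unfolding rotation_matrix_def by blast
  have X: "X = Q ** diag_mat (\<lambda>i. a (b i)) ** transpose Q"
    by (rule diagonalized_by_eigenvectors[OF Q(1)]) (use Q(2) in \<open>auto simp: V_def\<close>)
  have dims: "dim (V j) = card {i :: 'n. block k i = j}" if j: "j \<in> {1..Suc p}" for j
  proof -
    obtain q :: "real poly" where q: "degree q \<le> p" "\<forall>l\<in>{1..Suc p}. poly q (a l) = of_bool (l = j)"
      using exists_interpolation[OF inj_a, of "\<lambda>l. of_bool (l = j)"] by blast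
    \<comment> \<open>the trace conditions start at \<open>m = 1\<close>; for \<open>m = 0\<close> both sides count all indices\<close>
    have pw: "(\<Sum>l=1..Suc p. real (dim (V l)) * a l ^ m) = (\<Sum>l=1..Suc p. real (card {i :: 'n. block k i = l}) * a l ^ m)"
      if "m \<le> p" for m
    proof -
      have "(\<Sum>l=1..Suc p. real (dim (V l)) * a l ^ m) = (\<Sum>l=1..Suc p. real (card {i. b i = l}) * a l ^ m)"
        using b(2) by (intro sum.cong refl) simp
      also have "\<dots> = (\<Sum>i\<in>UNIV. a (b i) ^ m)"
        by (rule sum_over_blocks[OF br, of "\<lambda>j. a j ^ m", symmetric])
      also have "\<dots> = (\<Sum>i\<in>(UNIV :: 'n set). a (block k i) ^ m)"
      proof (cases "m = 0")
        case False
        have "(\<Sum>i\<in>UNIV. a (b i) ^ m) = trace (matrix_power X m)"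
          by (simp only: X matrix_power_conj[OF Q(1)] trace_conj[OF Q(1)] trace_diag_mat)
        also have "\<dots> = (\<Sum>l=1..Suc p. real (card {i :: 'n. block k i = l}) * a l ^ m)"
          using tr[of m] that False by (simp only: sum_block_dims[of "\<lambda>j. a j ^ m"]) simp
        finally show ?thesis by (simp only: sum_over_blocks[OF block_range, of "\<lambda>j. a j ^ m"])
      qed simp
      also have "\<dots> = (\<Sum>l=1..Suc p. real (card {i :: 'n. block k i = l}) * a l ^ m)"
        by (rule sum_over_blocks[OF block_range, of "\<lambda>j. a j ^ m"])
      finally show ?thesis .
    qed
    have eval: "(\<Sum>l=1..Suc p. c l * poly q (a l)) = (\<Sum>m\<le>degree q. coeff q m * (\<Sum>l=1..Suc p. c l * a l ^ m))" for c
      unfolding poly_altdef sum_distrib_left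
      by (subst sum.swap) (simp only: mult.left_commute)
    have pick: "(\<Sum>l=1..Suc p. c l * poly q (a l)) = c j" for c
    proof -
      have "(\<Sum>l=1..Suc p. c l * poly q (a l)) = (\<Sum>l=1..Suc p. if l = j then c l else 0)"
        using q(2) by (intro sum.cong refl) auto
      then show ?thesis using j by simp
    qed
    have "real (dim (V j)) = (\<Sum>m\<le>degree q. coeff q m * (\<Sum>l=1..Suc p. real (dim (V l)) * a l ^ m))"
      by (simp only: eval[symmetric] pick)
    also have "\<dots> = (\<Sum>m\<le>degree q. coeff q m * (\<Sum>l=1..Suc p. real (card {i :: 'n. block k i = l}) * a l ^ m))"
      using q(1) by (intro sum.cong refl arg_cong[of _ _ "\<lambda>x. _ * x"] pw) simp
    also have "\<dots> = real (card {i :: 'n. block k i = j})"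
      by (simp only: eval[symmetric] pick)
    finally show ?thesis by simp
  qed
  have "\<exists>Q :: 'n rmat. rotation_matrix Q \<and> (\<forall>i. column i Q \<in> V (block k i))"
    by (rule rotation_with_columns_in[OF subV orth dims]) (use block_range in auto)
  then obtain R :: "'n rmat" where R: "rotation_matrix R" "\<And>i. column i R \<in> V (block k i)" by blast
  have "X = R ** diag_mat (\<lambda>i. a (block k i)) ** transpose R"
    by (rule diagonalized_by_eigenvectors) (use R in \<open>auto simp: V_def rotation_matrix_def\<close>)
  then show ?thesis using R(1) by (auto simp: block_diag_diag_mat)
qed

lemma isospectral_eq: "isospectral = {spectral_matrix Q |Q. rotation_matrix Q}"
  using isospectral_has_rotation spectral_matrix_in_isospectral by (auto simp: rotation_matrix_def)

section \<open>The map from spectral matrices to flags\<close>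

lemma flag_projection:
  fixes Q A :: "'n rmat"
  assumes Q: "orthogonal_matrix Q" and A: "invertible A" and eq: "column_flag p k Q = column_flag p k A"
    and j: "j \<le> Suc p"
  shows "Q ** leading k j ** transpose Q = image_projection (leading k j) A"
  by (rule orthogonal_projection_unique)
    (simp_all only: orthogonal_conj_projection[OF Q leading_idem transpose_leading]
      image_projection[OF A leading_idem transpose_leading]
      column_flag_eqD[OF eq invertible_orthogonal[OF Q] A j])

lemma spectral_matrix_sum:
  "spectral_matrix Q = (\<Sum>j=1..Suc p. a j *\<^sub>R (Q ** leading k j ** transpose Q - Q ** leading k (j - 1) ** transpose Q))"
  unfolding block_diag_eq matrix_sum_ldistrib matrix_sum_rdistrib
  by (simp only: bounded_bilinear.scaleR_left[OF bounded_bilinear_matrix_mul]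
        bounded_bilinear.scaleR_right[OF bounded_bilinear_matrix_mul] matrix_diff_ldistrib matrix_diff_rdistrib)

text \<open>
  Evaluated at a spectral matrix, this polynomial yields the orthogonal projection onto the \<open>j\<close>-th member
  of the flag; this is how the flag depends smoothly on the matrix.
\<close>

definition step_poly :: "nat \<Rightarrow> real poly" where
  "step_poly j = (SOME q. \<forall>l\<in>{1..Suc p}. poly q (a l) = of_bool (l \<le> j))"

definition eigenprojection :: "nat \<Rightarrow> 'n rmat \<Rightarrow> 'n rmat" where
  "eigenprojection j X = matrix_poly (step_poly j) X"

lemma eigenprojection_spectral_matrix:
  assumes Q: "orthogonal_matrix Q" and j: "j \<le> Suc p"
  shows "eigenprojection j (spectral_matrix Q) = Q ** leading k j ** transpose Q"
proof -
  have "\<exists>q. \<forall>l\<in>{1..Suc p}. poly q (a l) = of_bool (l \<le> j)"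
    using exists_interpolation[OF inj_a, of "\<lambda>l. of_bool (l \<le> j)"] by blast
  then have "\<forall>l\<in>{1..Suc p}. poly (step_poly j) (a l) = of_bool (l \<le> j)"
    unfolding step_poly_def by (rule someI_ex)
  then have "poly (step_poly j) (a (block k i)) = of_bool (block k i \<le> j)" for i :: 'n
    using block_range by blast
  then show ?thesis
    by (simp add: eigenprojection_def block_diag_diag_mat matrix_poly_conj[OF Q] leading_block[OF j])
qed

text \<open>
  Each side determines the orthogonal projections onto the members of the flag: the matrix because they
  are polynomials in it, the flag by uniqueness of orthogonal projections.  Conversely, the matrix is a
  linear combination of them and the flag consists of their column spaces.
\<close>

lemma spectral_matrix_eq_iff:
  assumes Q: "orthogonal_matrix Q" and R: "orthogonal_matrix R"
  shows "spectral_matrix Q = spectral_matrix R \<longleftrightarrow> column_flag p k Q = column_flag p k R"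
proof
  assume eq: "spectral_matrix Q = spectral_matrix R"
  show "column_flag p k Q = column_flag p k R"
  proof (rule column_flag_eqI)
    fix j assume "j \<in> {1..p}"
    then have "Q ** leading k j ** transpose Q = R ** leading k j ** transpose R"
      using eigenprojection_spectral_matrix[OF Q, of j] eigenprojection_spectral_matrix[OF R, of j] eq by simp
    then show "colspace (Q ** leading k j) = colspace (R ** leading k j)"
      using orthogonal_conj_projection(3)[OF Q leading_idem transpose_leading]
        orthogonal_conj_projection(3)[OF R leading_idem transpose_leading] by metis
  qed
next
  assume eq: "column_flag p k Q = column_flag p k R"
  have *: "Q ** leading k j ** transpose Q = R ** leading k j ** transpose R" if "j \<le> Suc p" for j
    using flag_projection[OF Q invertible_orthogonal[OF R] eq that]
      flag_projection[OF R invertible_orthogonal[OF R] refl that] by simp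
  show "spectral_matrix Q = spectral_matrix R"
    unfolding spectral_matrix_sum
  proof (intro sum.cong refl)
    fix j assume "j \<in> {1..Suc p}"
    then have "j \<le> Suc p" "j - 1 \<le> Suc p" by auto
    then show "a j *\<^sub>R (Q ** leading k j ** transpose Q - Q ** leading k (j - 1) ** transpose Q)
        = a j *\<^sub>R (R ** leading k j ** transpose R - R ** leading k (j - 1) ** transpose R)"
      by (simp only: *)
  qed
qed

lemma phi4_spectral_matrix:
  assumes "rotation_matrix Q"
  shows "phi4 p k a (spectral_matrix Q) = column_flag p k Q"
  unfolding phi4_def
proof (rule the_equality)
  fix F assume "\<exists>R. rotation_matrix R \<and> spectral_matrix Q = spectral_matrix R \<and> F = column_flag p k R"
  then obtain R where "rotation_matrix R" "spectral_matrix Q = spectral_matrix R" "F = column_flag p k R"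
    by blast
  then show "F = column_flag p k Q"
    using assms spectral_matrix_eq_iff[of Q R] by (simp add: rotation_matrix_def)
qed (use assms in blast)

lemma bij_betw_phi4: "bij_betw (phi4 p k a) isospectral (flag_set p k)"
proof (rule bij_betw_imageI)
  show "inj_on (phi4 p k a) isospectral"
  proof (rule inj_onI)
    fix X Y assume "X \<in> isospectral" "Y \<in> isospectral" and eq: "phi4 p k a X = phi4 p k a Y"
    then obtain Q R where QR: "rotation_matrix Q" "X = spectral_matrix Q" "rotation_matrix R" "Y = spectral_matrix R"
      using isospectral_has_rotation by meson
    then show "X = Y"
      using eq spectral_matrix_eq_iff[of Q R] by (simp add: phi4_spectral_matrix) (simp add: rotation_matrix_def)
  qed
  have "phi4 p k a X \<in> flag_set p k" if X: "X \<in> isospectral" for X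
  proof -
    obtain Q where Q: "rotation_matrix Q" "X = spectral_matrix Q"
      using isospectral_has_rotation[OF X] by blast
    then show ?thesis
      using column_flag_in_flag_set[OF invertible_orthogonal] phi4_spectral_matrix[OF Q(1)]
      by (simp add: rotation_matrix_def)
  qed
  moreover have "F \<in> phi4 p k a ` isospectral" if F: "F \<in> flag_set p k" for F
  proof -
    obtain Q :: "'n rmat" where Q: "rotation_matrix Q" "column_flag p k Q = F"
      using flag_has_rotation[OF F] by blast
    then have "F = phi4 p k a (spectral_matrix Q)" "spectral_matrix Q \<in> isospectral"
      using phi4_spectral_matrix spectral_matrix_in_isospectral by (simp_all add: rotation_matrix_def)
    then show ?thesis by blast
  qed
  ultimately show "phi4 p k a ` isospectral = flag_set p k" by blast
qed

section \<open>Cells in the isospectral model\<close>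

text \<open>
  The inverse of the pulled-back chart: the point of the isospectral model over the flag with cell
  coordinate \<open>N\<close>.
\<close>

definition cell_matrix :: "'n rmat \<Rightarrow> 'n rmat \<Rightarrow> 'n rmat" where
  "cell_matrix g N = (\<Sum>j=1..Suc p. a j *\<^sub>R
     (image_projection (leading k j) (g ** (mat 1 + N)) - image_projection (leading k (j - 1)) (g ** (mat 1 + N))))"

lemma cell_matrix:
  assumes g: "invertible g" and N: "N \<in> strictly_block_lower k"
  shows "cell_matrix g N \<in> isospectral" "phi4 p k a (cell_matrix g N) = cell_param p k g N"
proof -
  let ?A = "g ** (mat 1 + N)"
  obtain Q :: "'n rmat" where Q: "rotation_matrix Q" "column_flag p k Q = column_flag p k ?A"
    using flag_has_rotation[OF column_flag_in_flag_set[OF invertible_cell[OF N g]]] by blast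
  have Qo: "orthogonal_matrix Q" using Q(1) by (simp add: rotation_matrix_def)
  have "cell_matrix g N = spectral_matrix Q"
    unfolding cell_matrix_def spectral_matrix_sum
  proof (intro sum.cong refl)
    fix j assume "j \<in> {1..Suc p}"
    then have "j \<le> Suc p" "j - 1 \<le> Suc p" by auto
    then show "a j *\<^sub>R (image_projection (leading k j) ?A - image_projection (leading k (j - 1)) ?A)
        = a j *\<^sub>R (Q ** leading k j ** transpose Q - Q ** leading k (j - 1) ** transpose Q)"
      by (simp only: flag_projection[OF Qo invertible_cell[OF N g] Q(2)])
  qed
  then show "cell_matrix g N \<in> isospectral" "phi4 p k a (cell_matrix g N) = cell_param p k g N"
    using spectral_matrix_in_isospectral[OF Qo] phi4_spectral_matrix[OF Q(1)] Q(2)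
    by (simp_all add: cell_param_def)
qed

text \<open>
  The columns span \<open>g\<^sup>-\<^sup>1\<close> of the \<open>j\<close>-th member of the flag of \<open>X\<close>.
\<close>

definition cell_frame :: "'n rmat \<Rightarrow> nat \<Rightarrow> 'n rmat \<Rightarrow> 'n rmat" where
  "cell_frame g j X = matrix_inv g ** eigenprojection j X"

definition cell_gram :: "'n rmat \<Rightarrow> nat \<Rightarrow> 'n rmat \<Rightarrow> 'n rmat" where
  "cell_gram g j X = compress (leading k j) (cell_frame g j X ** transpose (cell_frame g j X))"

definition cell_domain :: "'n rmat \<Rightarrow> 'n rmat set" where
  "cell_domain g = {X. \<forall>j\<in>{1..Suc p}. invertible (cell_gram g j X)}"

text \<open>
  A right inverse, with values in the column space of the frame, of the projection to the first \<open>k\<^sub>j\<close>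
  coordinates (see \<open>leading_cell_lift\<close>).  For \<open>X\<close> over the cell, the space spanned by the frame is a graph
  over these coordinates, and this matrix parametrizes it.
\<close>

definition cell_lift :: "'n rmat \<Rightarrow> nat \<Rightarrow> 'n rmat \<Rightarrow> 'n rmat" where
  "cell_lift g j X = cell_frame g j X ** transpose (cell_frame g j X) ** leading k j **
     matrix_inv (cell_gram g j X) ** leading k j"

definition cell_coord :: "'n rmat \<Rightarrow> 'n rmat \<Rightarrow> 'n rmat" where
  "cell_coord g X = (\<Sum>j=1..Suc p. cell_lift g j X ** (leading k j - leading k (j - 1))) - mat 1"

lemma leading_cell_lift:
  assumes "invertible (cell_gram g j X)"
  shows "leading k j ** cell_lift g j X = leading k j"
proof -
  have "leading k j ** cell_lift g j X = (leading k j ** (cell_frame g j X ** transpose (cell_frame g j X)) **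
      leading k j ** matrix_inv (cell_gram g j X)) ** leading k j"
    by (simp add: cell_lift_def matrix_mul_assoc)
  also have "\<dots> = leading k j ** leading k j"
    using assms by (simp only: cell_gram_def compress_inverse(1)[OF leading_idem])
  finally show ?thesis by (simp add: leading_idem)
qed

text \<open>
  Each column of \<open>1 + cell_coord g X\<close> is the lift of a standard basis vector.  Being a lift makes the
  coordinate block lower triangular; lying in the \<open>j\<close>-th frame makes the leading columns span the
  flag of \<open>X\<close>, by comparison of dimensions.
\<close>

lemma cell_coord:
  assumes g: "invertible g" and X: "X \<in> isospectral" "X \<in> cell_domain g"
  shows "cell_coord g X \<in> strictly_block_lower k" "cell_param p k g (cell_coord g X) = phi4 p k a X"
proof -
  obtain Q where Q: "rotation_matrix Q" "X = spectral_matrix Q"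
    using isospectral_has_rotation[OF X(1)] by blast
  have Qo: "orthogonal_matrix Q" using Q(1) by (simp add: rotation_matrix_def)
  let ?Z = "mat 1 + cell_coord g X"
  have Z: "?Z $ r $ c = cell_lift g (block k c) X $ r $ c" for r c
    unfolding cell_coord_def by (simp only: add_diff_eq add_diff_cancel_left' sum_blocks)
  show N: "cell_coord g X \<in> strictly_block_lower k"
    unfolding strictly_block_lower_def
  proof (intro CollectI allI impI)
    fix r c assume ne: "cell_coord g X $ r $ c \<noteq> 0"
    show "block k c < block k r"
    proof (rule ccontr)
      assume "\<not> block k c < block k r"
      let ?j = "block k c"
      have j: "?j \<in> {1..Suc p}" by (rule block_range)
      then have "leading k ?j ** cell_lift g ?j X = leading k ?j"
        using X(2) by (intro leading_cell_lift) (simp add: cell_domain_def)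
      then have "(leading k ?j ** cell_lift g ?j X) $ r $ c = (leading k ?j :: 'n rmat) $ r $ c" by simp
      then have "?Z $ r $ c = mat 1 $ r $ c"
        using j \<open>\<not> block k c < block k r\<close> unfolding Z
        by (simp add: leading_block diag_mat_matrix_mul) (simp add: diag_mat_def mat_def)
      then show False using ne by simp
    qed
  qed
  have "column_flag p k (g ** ?Z) = column_flag p k Q"
  proof (rule column_flag_eqI_subset[OF invertible_cell[OF N g] invertible_orthogonal[OF Qo]])
    fix j assume j: "j \<in> {1..p}"
    show "colspace (g ** ?Z ** leading k j) \<subseteq> colspace (Q ** leading k j)"
    proof (rule colspace_subsetI[OF subspace_colspace])
      fix c :: 'n
      let ?l = "block k c"
      have col: "column c (g ** ?Z ** leading k j) = of_bool (?l \<le> j) *\<^sub>R column c (g ** ?Z)"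
        using j by (simp add: leading_block column_def matrix_mul_diag_mat vec_eq_iff)
      show "column c (g ** ?Z ** leading k j) \<in> colspace (Q ** leading k j)"
      proof (cases "?l \<le> j")
        case True
        have l: "?l \<le> Suc p" using block_range[of c] by simp
        let ?Y = "transpose (cell_frame g ?l X) ** leading k ?l ** matrix_inv (cell_gram g ?l X) ** leading k ?l"
        have "column c ?Z = column c (cell_lift g ?l X)"
          by (simp only: column_def Z)
        then have "column c (g ** ?Z) = column c (g ** cell_lift g ?l X)"
          by (simp only: column_mul)
        also have "g ** cell_lift g ?l X = g ** matrix_inv g ** (Q ** leading k ?l ** transpose Q) **
            ?Y"
          unfolding cell_lift_def
          by (subst (1) cell_frame_def) (simp only: Q(2) eigenprojection_spectral_matrix[OF Qo l] matrix_mul_assoc)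
        also have "\<dots> = (Q ** leading k ?l) ** (transpose Q **
            ?Y)"
          by (simp add: matrix_inv_mul[OF g] matrix_mul_assoc)
        finally have "column c (g ** ?Z) = column c (Q ** leading k ?l ** (transpose Q ** ?Y))" .
        then have "column c (g ** ?Z) \<in> colspace (Q ** leading k ?l)"
          using subsetD[OF colspace_mul_subset column_in_colspace] by simp
        then show ?thesis
          using True j colspace_leading_mono[of ?l j Q] col by auto
      next
        case False
        then show ?thesis using col subspace_0[OF subspace_colspace] by simp
      qed
    qed
  qed
  then show "cell_param p k g (cell_coord g X) = phi4 p k a X"
    using phi4_spectral_matrix[OF Q(1)] Q(2) by (simp add: cell_param_def)
qed

text \<open>
  The criterion of \<open>invertible_compress\<close> holds with \<open>Y = A E (1 + N)\<^sup>-\<^sup>1\<close> where \<open>A = g (1 + N)\<close>: the projection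
  onto the flag fixes \<open>A E\<close>, and \<open>E (1 + N) E = E (1 + N)\<close> because \<open>N\<close> is lower triangular.
\<close>

lemma cell_in_domain:
  assumes g: "invertible g" and X: "X \<in> isospectral" and N: "N \<in> strictly_block_lower k"
    and eq: "phi4 p k a X = cell_param p k g N"
  shows "X \<in> cell_domain g"
  unfolding cell_domain_def
proof (intro CollectI ballI)
  fix j assume "j \<in> {1..Suc p}"
  then have j: "j \<le> Suc p" by simp
  obtain Q where Q: "rotation_matrix Q" "X = spectral_matrix Q"
    using isospectral_has_rotation[OF X] by blast
  have Qo: "orthogonal_matrix Q" using Q(1) by (simp add: rotation_matrix_def)
  let ?E = "leading k j :: 'n rmat" and ?A = "g ** (mat 1 + N)" and ?T = "matrix_inv (mat 1 + N)"
  let ?P = "Q ** ?E ** transpose Q"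
  note P = orthogonal_conj_projection[OF Qo leading_idem[of k j] transpose_leading[of k j]]
  have A: "invertible ?A" by (rule invertible_cell[OF N g])
  have "column_flag p k Q = column_flag p k ?A"
    using eq Q phi4_spectral_matrix by (simp add: cell_param_def)
  then have "colspace (?A ** ?E) = colspace ?P"
    using column_flag_eqD[OF _ invertible_orthogonal[OF Qo] A j] P(3) by simp
  then have PA: "?P ** (?A ** ?E) = ?A ** ?E"
    by (intro fix_colspace[OF P(2)]) simp
  have "?E ** cell_frame g j X ** (?A ** ?E ** ?T) = ?E ** matrix_inv g ** (?P ** (?A ** ?E)) ** ?T"
    by (simp only: cell_frame_def Q(2) eigenprojection_spectral_matrix[OF Qo j] matrix_mul_assoc)
  also have "\<dots> = ?E ** (matrix_inv g ** g) ** (mat 1 + N) ** ?E ** ?T"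
    unfolding PA by (simp only: matrix_mul_assoc)
  also have "\<dots> = ?E ** (mat 1 + N) ** ?E ** ?T"
    by (simp add: matrix_inv_mul[OF g])
  also have "\<dots> = ?E ** ((mat 1 + N) ** ?T)"
    by (simp only: leading_unipotent[OF N j] matrix_mul_assoc)
  also have "\<dots> = ?E" by (simp add: matrix_inv_mul[OF invertible_unipotent[OF N]])
  finally show "invertible (cell_gram g j X)"
    unfolding cell_gram_def by (rule invertible_compress[OF leading_idem transpose_leading])
qed

lemma smooth_on_cell_matrix:
  assumes g: "invertible g"
  shows "smooth_on (strictly_block_lower k) (cell_matrix g)"
proof -
  let ?A = "\<lambda>N :: 'n rmat. g ** (mat 1 + N)"
  let ?W = "{N. invertible (?A N)}"
  have hdA: "higher_differentiable_on V ?A m" if "open V" for V m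
    using that by (intro hdiff_on_matrix_mul hdiff_on_const hdiff_on_add hdiff_on_id)
  have W: "open ?W"
    by (intro open_invertible_preimage hdiff_on_continuous_on[where m = 0] hdA) simp
  have "higher_differentiable_on ?W (\<lambda>N. image_projection (leading k j) (?A N)) m" for j m
    unfolding image_projection_def
    by (intro hdiff_on_matrix_mul W hdiff_on_const hdiff_on_transpose hdA hdiff_on_matrix_inv hdiff_on_compress)
      (simp add: invertible_compress_gram leading_idem transpose_leading)
  then have "higher_differentiable_on ?W (cell_matrix g) m" for m
    unfolding cell_matrix_def[abs_def] by (intro hdiff_on_sum hdiff_on_scaleR hdiff_on_diff W)
  then show ?thesis
    by (intro smooth_onI[of _ "\<lambda>_. ?W" "\<lambda>_. cell_matrix g"] W) (auto intro: invertible_cell g)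
qed

lemma hdiff_on_cell_frame: "open W \<Longrightarrow> higher_differentiable_on W (cell_frame g j) m"
  unfolding cell_frame_def[abs_def] eigenprojection_def by (intro hdiff_on_matrix_mul hdiff_on_const hdiff_on_matrix_poly)

lemma hdiff_on_cell_gram: "open W \<Longrightarrow> higher_differentiable_on W (cell_gram g j) m"
  unfolding cell_gram_def[abs_def] by (intro hdiff_on_compress hdiff_on_matrix_mul hdiff_on_transpose hdiff_on_cell_frame)

lemma open_cell_domain: "open (cell_domain g)"
proof -
  have "cell_domain g = (\<Inter>j\<in>{1..Suc p}. {X. invertible (cell_gram g j X)})"
    by (auto simp: cell_domain_def)
  also have "open \<dots>"
    by (intro open_INT ballI open_invertible_preimage hdiff_on_continuous_on[where m = 0] hdiff_on_cell_gram) auto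
  finally show ?thesis .
qed

lemma smooth_on_cell_coord: "smooth_on (isospectral \<inter> cell_domain g) (cell_coord g)"
proof -
  note W = open_cell_domain[of g]
  have "higher_differentiable_on (cell_domain g) (cell_lift g j) m" if "j \<in> {1..Suc p}" for j m
    unfolding cell_lift_def[abs_def]
    by (intro hdiff_on_matrix_mul W hdiff_on_const hdiff_on_transpose hdiff_on_cell_frame hdiff_on_matrix_inv hdiff_on_cell_gram)
      (use that in \<open>simp add: cell_domain_def\<close>)
  then have "higher_differentiable_on (cell_domain g) (cell_coord g) m" for m
    unfolding cell_coord_def[abs_def] by (intro hdiff_on_diff hdiff_on_sum W hdiff_on_matrix_mul hdiff_on_const)
  then show ?thesis
    by (intro smooth_onI[of _ "\<lambda>_. cell_domain g" "\<lambda>_. cell_coord g"] W) auto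
qed

text \<open>
  On this domain the chart is given by the formula \<open>cell_coord\<close> and its inverse by the formula \<open>cell_matrix\<close>,
  although both are defined through choice operators.
\<close>

lemma cell_chart_pulled_back:
  fixes g :: "'n rmat"
  assumes g: "invertible g"
  shows "(isospectral \<inter> phi4 p k a -` cell_param p k g ` strictly_block_lower k,
      inv_into (strictly_block_lower k) (cell_param p k g) \<circ> phi4 p k a) \<in> submanifold_atlas isospectral"
proof -
  let ?L = "strictly_block_lower k :: 'n rmat set" and ?c = "cell_param p k g"
  let ?U = "isospectral \<inter> phi4 p k a -` ?c ` ?L" and ?\<phi> = "inv_into ?L ?c \<circ> phi4 p k a"
  have U: "?U = isospectral \<inter> cell_domain g"
    using cell_in_domain[OF g] cell_coord[OF g] by (auto, metis image_eqI)
  have coord: "?\<phi> X = cell_coord g X" if "X \<in> ?U" for X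
    using cell_coord[OF g, of X] that unfolding U
    by (auto intro!: inv_into_f_eq[OF cell_param_inj[OF g]])
  have mat: "cell_matrix g N \<in> ?U" "?\<phi> (cell_matrix g N) = N" if "N \<in> ?L" for N
    using cell_matrix[OF g that] that by (auto intro!: inv_into_f_eq[OF cell_param_inj[OF g]])
  have inj: "inj_on ?\<phi> ?U"
  proof (rule inj_onI)
    fix X Y assume "X \<in> ?U" "Y \<in> ?U" "?\<phi> X = ?\<phi> Y"
    then have "phi4 p k a X = phi4 p k a Y"
      using f_inv_into_f by (metis IntD2 comp_apply vimageD)
    then show "X = Y"
      using bij_betw_imp_inj_on[OF bij_betw_phi4] \<open>X \<in> ?U\<close> \<open>Y \<in> ?U\<close> by (auto dest: inj_onD)
  qed
  have img: "?\<phi> ` ?U = ?L"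
  proof
    show "?\<phi> ` ?U \<subseteq> ?L" by (auto intro: inv_into_into)
    show "?L \<subseteq> ?\<phi> ` ?U" using mat by (metis image_eqI subsetI)
  qed
  have inv: "inv_into ?U ?\<phi> N = cell_matrix g N" if "N \<in> ?L" for N
    by (rule inv_into_f_eq[OF inj mat[OF that]])
  have "openin (top_of_set isospectral) ?U"
    unfolding U by (simp add: openin_open_Int open_cell_domain)
  moreover have "smooth_on ?U ?\<phi>"
    by (rule smooth_on_cong_subset[OF smooth_on_cell_coord[of g]]) (use U coord in auto)
  moreover have "smooth_on (?\<phi> ` ?U) (inv_into ?U ?\<phi>)"
    unfolding img by (rule smooth_on_cong_subset[OF smooth_on_cell_matrix[OF g] order_refl]) (simp only: inv)
  moreover have "openin (top_of_set ?L) (?\<phi> ` ?U)"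
    unfolding img by simp
  ultimately show ?thesis
    unfolding submanifold_atlas_def using inj subspace_strictly_block_lower by blast
qed

lemma flag_atlas_cover:
  "(\<Union>(V, \<psi>)\<in>(flag_atlas p k :: (nat \<Rightarrow> 'n rvec set, 'n rmat) chart set). V) = flag_set p k"
proof
  show "(\<Union>(V, \<psi>)\<in>(flag_atlas p k :: (nat \<Rightarrow> 'n rvec set, 'n rmat) chart set). V) \<subseteq> flag_set p k"
    using column_flag_in_flag_set[OF invertible_cell]
    by (auto simp: flag_atlas_def cell_param_def)
  show "flag_set p k \<subseteq> (\<Union>(V, \<psi>)\<in>(flag_atlas p k :: (nat \<Rightarrow> 'n rvec set, 'n rmat) chart set). V)"
  proof
    fix F :: "nat \<Rightarrow> 'n rvec set" assume "F \<in> flag_set p k"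
    then obtain Q :: "'n rmat" where Q: "rotation_matrix Q" "column_flag p k Q = F"
      using flag_has_rotation by blast
    have "F = cell_param p k Q 0" using Q(2) by (simp add: cell_param_def)
    moreover have "0 \<in> (strictly_block_lower k :: 'n rmat set)"
      by (rule subspace_0[OF subspace_strictly_block_lower])
    moreover have "invertible Q" using Q(1) by (simp add: rotation_matrix_def invertible_orthogonal)
    ultimately show "F \<in> (\<Union>(V, \<psi>)\<in>(flag_atlas p k :: (nat \<Rightarrow> 'n rvec set, 'n rmat) chart set). V)"
      by (auto simp: flag_atlas_def)
  qed
qed

lemma diffeomorphism_phi4:
  "diffeomorphism isospectral (submanifold_atlas isospectral) (flag_set p k) (flag_atlas p k) (phi4 p k a)"
proof (rule diffeomorphism_from_submanifold[OF bij_betw_phi4 flag_atlas_cover])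
  let ?L = "strictly_block_lower k :: 'n rmat set"
  show "dim ?L \<le> DIM('n rmat)" by (rule dim_subset_UNIV)
  fix V and \<psi> :: "(nat \<Rightarrow> 'n rvec set) \<Rightarrow> 'n rmat"
  assume "(V, \<psi>) \<in> flag_atlas p k"
  then obtain g :: "'n rmat" where g: "invertible g"
    "V = cell_param p k g ` ?L" "\<psi> = inv_into ?L (cell_param p k g)"
    by (auto simp: flag_atlas_def)
  have "\<psi> ` V = ?L" unfolding g(2,3) by (rule inv_into_image_cancel[OF cell_param_inj[OF g(1)] order_refl])
  then show "\<exists>E. subspace E \<and> dim E = dim ?L \<and> openin (top_of_set E) (\<psi> ` V)"
    using subspace_strictly_block_lower by (intro exI[of _ ?L]) simp
  show "(isospectral \<inter> phi4 p k a -` V, \<psi> \<circ> phi4 p k a) \<in> submanifold_atlas isospectral"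
    unfolding g(2,3) by (rule cell_chart_pulled_back[OF g(1)])
qed

end

theorem lemma5p1:
  fixes p :: nat and k :: "nat \<Rightarrow> nat" and a :: "nat \<Rightarrow> real"
  assumes "p \<ge> 1"
    and "k 0 = 0"
    and "\<forall>j\<le>p. k j < k (Suc j)"
    and "k (Suc p) = CARD('n::{finite,linorder})"
    and "inj_on a {1..Suc p}"
  shows "(isospectral_flags p k a :: 'n rmat set) =
           {Q ** block_diag k a ** transpose Q |Q. rotation_matrix Q} \<and>
         (\<forall>Q :: 'n rmat. rotation_matrix Q \<longrightarrow>
           phi4 p k a (Q ** block_diag k a ** transpose Q) = column_flag p k Q) \<and>
         diffeomorphism
           (isospectral_flags p k a) (submanifold_atlas (isospectral_flags p k a))
           (flag_set p k) (flag_atlas p k)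
           (phi4 p k a :: 'n rmat \<Rightarrow> nat \<Rightarrow> 'n rvec set)"
proof -
  interpret isospectral_dims p k "TYPE('n)" a
    using assms by unfold_locales auto
  show ?thesis
    using isospectral_eq phi4_spectral_matrix diffeomorphism_phi4 by blast
qed

end
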